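(* Let $|q|<1$ and define integers $g_1(n)$ ($n\ge 0$) by $$(-q,-q^{4};q^{5})_{\infty}^{2}(q^{4},q^{6};q^{10})_{\infty}=\sum_{n=0}^{\infty}g_{1}(n)q^{n}.$$ Then $$(-q,-q^{4};q^{5})_{\infty}^{2}(q^{4},q^{6};q^{10})_{\infty}=G_{0}(q^{5})+qG_{1}(q^{5})+q^{2}G_{2}(q^{5})+q^{4}G_{4}(q^{5}),$$ where \begin{align*} G_{0}(q) &=\sum_{n=0}^{\infty}g_{1}(5n)q^{n}=\frac{1}{(q,q^{4};q^{5})_{\infty}^{2}(q^{2},q^{8};q^{10})_{\infty}},\\ G_{1}(q) &=\sum_{n=0}^{\infty}g_{1}(5n+1)q^{n}=\frac{2}{(q,q^{2},q^{3},q^{4};q^{5})_{\infty}(q^{2},q^{8};q^{10})_{\infty}},\\ G_{2}(q) &=\sum_{n=0}^{\infty}g_{1}(5n+2)q^{n}=\frac{1}{(q,q^{4};q^{5})_{\infty}^{2}(q^{4},q^{6};q^{10})_{\infty}},\\ G_{4}(q) &=\sum_{n=0}^{\infty}g_{1}(5n+4)q^{n}=\frac{1}{(q^{2},q^{3};q^{5})_{\infty}^{2}(q^{4},q^{6};q^{10})_{\infty}}. \end{align*}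
   Context: Notation: for $|q|<1$, $(a;q)_{\infty}:=\prod_{n=0}^{\infty}(1-aq^{n})$ and $(a_{1},\ldots,a_{m};q)_{\infty}:=(a_{1};q)_{\infty}\cdots(a_{m};q)_{\infty}$; similarly with $q$ replaced by $q^k$ in the base. *)

theory Defs
  imports "HOL-Analysis.Analysis"
begin

text \<open>
  The infinite \<open>q\<close>-shifted factorial \<open>(a; q)\<^sub>\<infinity>\<close>. It is only meant for \<open>norm q < 1\<close>, where the
  product converges in the sense of \<^const>\<open>has_prod\<close>.
\<close>
definition qpoch :: "complex \<Rightarrow> complex \<Rightarrow> complex" where
  "qpoch a q = (\<Prod>n. 1 - a * q ^ n)"

text \<open>\<open>(a\<^sub>1, \<dots>, a\<^sub>m; q)\<^sub>\<infinity> = (a\<^sub>1; q)\<^sub>\<infinity> \<cdots> (a\<^sub>m; q)\<^sub>\<infinity>\<close>\<close>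
definition qpochs :: "complex list \<Rightarrow> complex \<Rightarrow> complex" where
  "qpochs as q = prod_list (map (\<lambda>a. qpoch a q) as)"

definition gen_prod :: "complex \<Rightarrow> complex" where
  "gen_prod q = (qpochs [- q, - (q ^ 4)] (q ^ 5))\<^sup>2 * qpochs [q ^ 4, q ^ 6] (q ^ 10)"

text \<open>
  The integer coefficients of the power series of \<^const>\<open>gen_prod\<close> on the open unit disc. They are
  unique by the identity theorem for power series; that they exist as integers is not built into
  the definite description and has to be proved wherever it is used.
\<close>
definition g1 :: "nat \<Rightarrow> int" where
  "g1 = (THE g. \<forall>q::complex. norm q < 1 \<longrightarrow> (\<lambda>n. of_int (g n) * q ^ n) sums gen_prod q)"

definition G :: "nat \<Rightarrow> complex \<Rightarrow> complex" where
  "G r q = (\<Sum>n. of_int (g1 (5 * n + r)) * q ^ n)"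

end

theory Submission
  imports Defs "HOL-Complex_Analysis.Complex_Analysis"
begin

text \<open>
  Write \<open>j(z; q) = (z, q/z, q; q)\<^sub>\<infinity>\<close> for the theta product and \<open>E\<^sub>m = (q\<^sup>m; q\<^sup>m)\<^sub>\<infinity>\<close>. With \<open>q = x\<^sup>5\<close>,
  the product to be dissected is
  \<open>j(-x; q)\<^sup>2 j(q x; q\<^sup>2) / (E\<^sub>1\<^sup>2 E\<^sub>2)\<close>, and the denominator depends on \<open>x\<^sup>5\<close> only, so
  it suffices to dissect the numerator, a product of three theta series.

  The Jacobi triple product turns a product of two theta functions into a double series over
  \<open>\<int>\<^sup>2\<close>, and splitting \<open>\<int>\<^sup>2\<close> into the cosets of a sublattice on which the quadratic form
  \<open>m\<^sup>2 + n\<^sup>2\<close> is again diagonal gives identities between theta functions. Only two such sublattices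
  occur: the one spanned by \<open>(1, 1)\<close> and \<open>(-1, 1)\<close>, of index two (\<open>jtheta_mult\<close>), and the one
  spanned by \<open>(2, 1)\<close> and \<open>(1, -2)\<close>, of index five (\<open>jtheta_mult_5\<close>). The first one rewrites
  \<open>j(-x; q)\<^sup>2\<close> as a combination of \<open>j(-x\<^sup>2; q\<^sup>2)\<close> and \<open>x j(-q x\<^sup>2; q\<^sup>2)\<close>, with coefficients
  \<open>\<phi> = j(-q; q\<^sup>2)\<close> and \<open>\<psi> = j(-1; q\<^sup>2)\<close>. The second one dissects each of the two products with
  \<open>j(q x; q\<^sup>2)\<close>: since \<open>x\<^sup>5 = q\<close>, the coset with index \<open>s\<close> contributes \<open>x\<^sup>s\<close> times a function of
  \<open>q\<close>, and one of the five theta factors in each product vanishes, which is why no exponent congruent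
  to \<open>3\<close> modulo \<open>5\<close> survives.

  What remains (\<open>mod5_squares\<close>) is to recognize the coefficients. With \<open>b\<^sub>n = j(-q\<^sup>n; q\<^sup>1\<^sup>0)\<close> and
  \<open>J\<^sub>n = j(q\<^sup>n; q\<^sup>5)\<close> they are
  \<open>\<phi> b\<^sub>4 - q \<psi> b\<^sub>1 = J\<^sub>2\<^sup>2\<close>, \<open>\<psi> b\<^sub>3 - \<phi> b\<^sub>2 = J\<^sub>1\<^sup>2\<close> and \<open>\<psi> b\<^sub>5 - q \<phi> b\<^sub>0 = 2 J\<^sub>1 J\<^sub>2\<close>.
  The index-two formula also expresses \<open>J\<^sub>2\<^sup>2\<close>, \<open>J\<^sub>1 J\<^sub>2\<close> and \<open>J\<^sub>1\<^sup>2\<close> as the components of a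
  cross product of two vectors formed from the \<open>b\<^sub>n\<close>;
  by linear algebra the three claims therefore follow from the two relations
  \<open>J\<^sub>2\<^sup>2 b\<^sub>3 + q J\<^sub>1\<^sup>2 b\<^sub>1 = \<phi> J\<^sub>1 J\<^sub>2\<close> and \<open>J\<^sub>2\<^sup>2 b\<^sub>2 + J\<^sub>1\<^sup>2 b\<^sub>4 = \<psi> J\<^sub>1 J\<^sub>2\<close>. After clearing products,
  the left-hand sides of these become sums of two theta products of modulus ten. Expanding them once
  more by the index-two formula, the first factors and the second has cancelling terms; in both
  cases only an identity between infinite products is left.

  It remains to pass from functions to coefficients. Locally uniform limits of polynomials with
  integer coefficients have integer Taylor coefficients, so the definite description
  \<^const>\<open>g1\<close> denotes the sequence of Taylor coefficients.
  Replacing \<open>x\<close> by \<open>\<omega> x\<close> for the five fifth roots of unity \<open>\<omega>\<close> leaves \<open>q\<close> fixed, hence separates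
  the residue classes and identifies each \<open>G r q\<close> with the corresponding product for \<open>q \<noteq> 0\<close>; both
  are continuous at \<open>q = 0\<close>.
\<close>

section \<open>Infinite products\<close>

lemma qpoch_has_prod:
  assumes "norm q < 1"
  shows "(\<lambda>n. 1 - a * q ^ n) has_prod qpoch a q"
proof -
  have "summable (\<lambda>n. norm ((1 - a * q ^ n) - 1))"
    using assms by (simp add: norm_mult norm_power summable_mult summable_geometric)
  then have "convergent_prod (\<lambda>n. 1 - a * q ^ n)"
    by (intro abs_convergent_prod_imp_convergent_prod summable_imp_abs_convergent_prod)
  then show ?thesis
    unfolding qpoch_def by (rule convergent_prod_has_prod)
qed

lemma qpoch_LIMSEQ:
  "norm q < 1 \<Longrightarrow> (\<lambda>n. \<Prod>k<n. 1 - a * q ^ k) \<longlonglongrightarrow> qpoch a q"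
  by (rule has_prod_imp_tendsto'[OF qpoch_has_prod])

lemma qpoch_eq_0_iff:
  "norm q < 1 \<Longrightarrow> qpoch a q = 0 \<longleftrightarrow> (\<exists>n. a * q ^ n = 1)"
  using has_prod_eq_0_iff[OF qpoch_has_prod[of q a]] by auto

lemma qpoch_nonzero:
  assumes "norm q < 1" "norm a < 1"
  shows "qpoch a q \<noteq> 0"
proof -
  have "norm (a * q ^ n) < 1" for n
  proof -
    have "norm (a * q ^ n) \<le> norm a * 1"
      unfolding norm_mult norm_power using assms
      by (intro mult_left_mono power_le_one) auto
    with assms show ?thesis by simp
  qed
  then have "a * q ^ n \<noteq> 1" for n
    by (metis norm_one less_irrefl)
  then show ?thesis
    using qpoch_eq_0_iff assms by blast
qed

lemma qpoch_rec:
  assumes "norm q < 1"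
  shows "qpoch a q = (1 - a) * qpoch (a * q) q"
proof -
  have "(\<lambda>n. (1 - a) * (\<Prod>k<n. 1 - a * q * q ^ k)) \<longlonglongrightarrow> (1 - a) * qpoch (a * q) q"
    by (intro tendsto_intros qpoch_LIMSEQ assms)
  moreover have "(1 - a) * (\<Prod>k<n. 1 - a * q * q ^ k) = (\<Prod>k<Suc n. 1 - a * q ^ k)" for n
    by (subst prod.lessThan_Suc_shift) (simp add: mult_ac)
  moreover have "(\<lambda>n. \<Prod>k<Suc n. 1 - a * q ^ k) \<longlonglongrightarrow> qpoch a q"
    by (rule LIMSEQ_Suc[OF qpoch_LIMSEQ[OF assms]])
  ultimately show ?thesis
    using LIMSEQ_unique by fastforce
qed

text \<open>The factors are sorted by the residue of their index modulo \<open>m\<close>.\<close>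
lemma qpoch_multisection:
  assumes "norm q < 1" "m > 0"
  shows "qpoch a q = (\<Prod>i<m. qpoch (a * q ^ i) (q ^ m))"
proof -
  have "norm (q ^ m) < 1"
    using assms by (simp add: norm_power power_less_one_iff)
  then have "(\<lambda>n. \<Prod>i<m. \<Prod>k<n. 1 - a * q ^ i * (q ^ m) ^ k)
      \<longlonglongrightarrow> (\<Prod>i<m. qpoch (a * q ^ i) (q ^ m))"
    by (intro tendsto_prod qpoch_LIMSEQ)
  moreover have "(\<Prod>i<m. \<Prod>k<n. 1 - a * q ^ i * (q ^ m) ^ k) = (\<Prod>k<n * m. 1 - a * q ^ k)" for n
  proof -
    have "(\<Prod>k<n. \<Prod>i = k * m..<k * m + m. 1 - a * q ^ i) = (\<Prod>k<n * m. 1 - a * q ^ k)"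
      by (rule prod.nat_group)
    moreover have "(\<Prod>i = k * m..<k * m + m. 1 - a * q ^ i) = (\<Prod>i<m. 1 - a * q ^ i * (q ^ m) ^ k)" for k
      by (rule prod.reindex_bij_witness[of _ "\<lambda>i. i + k * m" "\<lambda>i. i - k * m"])
         (auto simp: mult.assoc power_mult[symmetric] mult.commute[of k] simp flip: power_add)
    ultimately show ?thesis
      by (simp add: prod.swap[of _ "{..<n}"])
  qed
  moreover have "(\<lambda>n. \<Prod>k<n * m. 1 - a * q ^ k) \<longlonglongrightarrow> qpoch a q"
    using assms(2)
    by (intro filterlim_compose[OF qpoch_LIMSEQ[OF assms(1)]] mult_nat_right_at_top)
  ultimately show ?thesis
    using LIMSEQ_unique by fastforce
qed

lemma qpoch_mult_minus:
  assumes "norm q < 1"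
  shows "qpoch a q * qpoch (- a) q = qpoch (a\<^sup>2) (q\<^sup>2)"
proof -
  have "(\<lambda>n. (\<Prod>k<n. 1 - a * q ^ k) * (\<Prod>k<n. 1 - (- a) * q ^ k)) \<longlonglongrightarrow> qpoch a q * qpoch (- a) q"
    by (intro tendsto_intros qpoch_LIMSEQ assms)
  moreover have "(\<Prod>k<n. 1 - a * q ^ k) * (\<Prod>k<n. 1 - (- a) * q ^ k) = (\<Prod>k<n. 1 - a\<^sup>2 * (q\<^sup>2) ^ k)" for n
    unfolding prod.distrib[symmetric]
    by (intro prod.cong refl) (simp add: algebra_simps power2_eq_square power_mult_distrib)
  moreover have "(\<lambda>n. \<Prod>k<n. 1 - a\<^sup>2 * (q\<^sup>2) ^ k) \<longlonglongrightarrow> qpoch (a\<^sup>2) (q\<^sup>2)"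
    using assms by (intro qpoch_LIMSEQ) (simp add: norm_power power_less_one_iff)
  ultimately show ?thesis
    using LIMSEQ_unique by fastforce
qed

section \<open>The Jacobi triple product\<close>

text \<open>
  Dominated convergence for unordered sums; over the index set \<open>\<int>\<close> it turns the finite form of
  the triple product into the infinite one.
\<close>
lemma tendsto_infsum_dominated:
  fixes f :: "nat \<Rightarrow> 'a \<Rightarrow> 'b :: banach"
  assumes lim: "\<And>x. (\<lambda>n. f n x) \<longlonglongrightarrow> g x"
    and bound: "\<And>n x. norm (f n x) \<le> M x" and M: "M summable_on UNIV"
  shows "(\<lambda>n. \<Sum>\<^sub>\<infinity>x. f n x) \<longlonglongrightarrow> (\<Sum>\<^sub>\<infinity>x. g x)"
proof -
  have g: "norm (g x) \<le> M x" for x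
    by (rule Lim_bounded[OF tendsto_norm[OF lim]]) (use bound in auto)
  then have "(\<lambda>x. norm (g x)) summable_on UNIV"
    by (intro Infinite_Sum.abs_summable_on_comparison_test'[OF M]) auto
  then have "g summable_on UNIV"
    by (rule abs_summable_summable)
  then have lim_sum: "((\<lambda>X. \<Sum>x\<in>X. g x) \<longlongrightarrow> (\<Sum>\<^sub>\<infinity>x. g x)) (finite_subsets_at_top UNIV)"
    using has_sum_infsum unfolding has_sum_def by blast
  have unif: "uniform_limit UNIV (\<lambda>X n. \<Sum>x\<in>X. f n x) (\<lambda>n. \<Sum>\<^sub>\<infinity>x. f n x) (finite_subsets_at_top UNIV)"
    by (rule Weierstrass_m_test_general[OF _ M]) (use bound in auto)
  have "\<forall>\<^sub>F X in finite_subsets_at_top UNIV. (\<lambda>n. \<Sum>x\<in>X. f n x) \<longlonglongrightarrow> (\<Sum>x\<in>X. g x)"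
    by (intro always_eventually allI tendsto_sum lim)
  from swap_uniform_limit'[OF this lim_sum unif] show ?thesis
    by simp
qed

definition theta :: "complex \<Rightarrow> complex \<Rightarrow> complex" where
  "theta w q = (\<Sum>\<^sub>\<infinity>n::int. w powi n * q powi n\<^sup>2)"

text \<open>
  Writing the term as \<open>(c r\<^sup>n)\<^sup>n\<close>, it is eventually dominated by \<open>2\<^sup>-\<^sup>n\<close>, because \<open>c r\<^sup>n\<close> tends to \<open>0\<close>.
\<close>
lemma summable_gaussian:
  fixes c r :: real
  assumes "0 \<le> c" "0 \<le> r" "r < 1"
  shows "summable (\<lambda>n. c ^ n * r ^ n\<^sup>2)"
proof (rule summable_comparison_test_ev)
  have "(\<lambda>n. c * r ^ n) \<longlonglongrightarrow> c * 0"
    using assms by (intro tendsto_intros LIMSEQ_power_zero) auto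
  then have "\<forall>\<^sub>F n in sequentially. c * r ^ n < 1 / 2"
    by (rule order_tendstoD) auto
  then show "\<forall>\<^sub>F n in sequentially. norm (c ^ n * r ^ n\<^sup>2) \<le> (1 / 2) ^ n"
  proof eventually_elim
    case (elim n)
    have "norm (c ^ n * r ^ n\<^sup>2) = (c * r ^ n) ^ n"
      using assms by (simp add: power_mult_distrib power2_eq_square power_mult)
    also have "\<dots> \<le> (1 / 2) ^ n"
      using assms elim by (intro power_mono) auto
    finally show ?case .
  qed
qed (rule summable_geometric, simp)

lemma theta_abs_summable:
  fixes w q :: complex
  assumes "norm q < 1"
  shows "(\<lambda>n::int. norm (w powi n * q powi n\<^sup>2)) summable_on UNIV"
proof -
  let ?f = "\<lambda>n::int. norm (w powi n * q powi n\<^sup>2)"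
  have half: "(\<lambda>n. norm (v powi int n * q powi (int n)\<^sup>2)) summable_on UNIV" for v
  proof -
    have "norm (v powi (int n) * q powi (int n)\<^sup>2) = norm v ^ n * norm q ^ n\<^sup>2" for n
      using power_int_of_nat[of q "n\<^sup>2"] by (simp add: norm_mult norm_power)
    then show ?thesis
      using summable_gaussian[of "norm v" "norm q"] assms
      by (simp add: summable_nonneg_imp_summable_on)
  qed
  have "?f summable_on range int"
    using half[of w] by (subst summable_on_reindex) (auto simp: o_def)
  moreover have "?f summable_on range (\<lambda>n. - int n)"
    using half[of "inverse w"]
    by (subst summable_on_reindex) (auto simp: o_def inj_def power_int_minus power_inverse)
  ultimately have "?f summable_on (range int \<union> range (\<lambda>n. - int n))"
    by (rule summable_on_union)
  moreover have "range int \<union> range (\<lambda>n. - int n) = UNIV"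
  proof -
    have "n \<in> range int \<union> range (\<lambda>n. - int n)" for n
      by (cases n rule: int_cases2) auto
    then show ?thesis by blast
  qed
  ultimately show ?thesis by simp
qed

text \<open>
  The reciprocal of \<open>(p; p)\<^sub>m\<close>. The value \<open>0\<close> at negative \<open>m\<close> makes the recurrence
  \<open>inv_qfact_pred\<close> hold for all integers, so that sums over \<open>\<int>\<close> need no boundary terms.
\<close>
definition inv_qfact :: "complex \<Rightarrow> int \<Rightarrow> complex" where
  "inv_qfact p m = (if m < 0 then 0 else 1 / (\<Prod>k<nat m. 1 - p * p ^ k))"

lemma one_minus_power_nonzero:
  fixes p :: complex
  assumes "norm p < 1" shows "1 - p * p ^ k \<noteq> 0"
proof -
  have "norm (p ^ Suc k) < 1"
    using assms by (simp add: norm_power power_less_one_iff del: power_Suc)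
  then show ?thesis by (metis eq_iff_diff_eq_0 norm_one order_less_irrefl power_Suc)
qed

lemma inv_qfact_pred:
  assumes "norm p < 1"
  shows "inv_qfact p (m - 1) = (1 - p powi m) * inv_qfact p m"
proof (cases "m > 0")
  case True
  then obtain k where "m = int (Suc k)"
    by (metis Suc_pred' zero_less_imp_eq_int of_nat_0_less_iff)
  moreover from this have "nat (m - 1) = k" "nat m = Suc k"
    by simp_all
  ultimately show ?thesis
    using one_minus_power_nonzero[OF assms] by (simp add: inv_qfact_def nat_add_distrib power_int_add_1' del: of_nat_Suc)
qed (auto simp: inv_qfact_def)

text \<open>
  Up to the powers of \<open>q\<close>, the coefficient of \<open>w\<^sup>j\<close> is a Gaussian binomial coefficient with upper index
  \<open>2n\<close> and lower index \<open>n + j\<close>. The induction multiplies by the next pair of factors, whose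
  product is \<open>(1 + a\<^sup>2) + a w + a/w\<close> with \<open>a = q\<^sup>2\<^sup>n\<^sup>+\<^sup>1\<close>; comparing coefficients of \<open>w\<^sup>j\<close> gives a three-term
  recurrence for the Gaussian binomials.
\<close>
lemma finite_triple_product:
  assumes q: "norm q < 1" "q \<noteq> 0" and w: "w \<noteq> 0"
  shows "((\<lambda>j. (\<Prod>k<2 * n. 1 - q\<^sup>2 * (q\<^sup>2) ^ k) * inv_qfact (q\<^sup>2) (int n - j) * inv_qfact (q\<^sup>2) (int n + j)
            * (w powi j * q powi j\<^sup>2))
      has_sum (\<Prod>k<n. (1 + w * q * (q\<^sup>2) ^ k) * (1 + q / w * (q\<^sup>2) ^ k))) UNIV"
proof (induction n)
  case 0
  have "((\<lambda>j. inv_qfact (q\<^sup>2) (- j) * inv_qfact (q\<^sup>2) j * (w powi j * q powi j\<^sup>2)) has_sum 1) {0}"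
    by (rule has_sum_finiteI) (auto simp: inv_qfact_def)
  then have "((\<lambda>j. inv_qfact (q\<^sup>2) (- j) * inv_qfact (q\<^sup>2) j * (w powi j * q powi j\<^sup>2)) has_sum 1) UNIV"
    by (subst has_sum_cong_neutral[where T = "{0}"]) (auto simp: inv_qfact_def)
  then show ?case by simp
next
  case (Suc n)
  define p where "p = q\<^sup>2"
  have p: "norm p < 1" "p \<noteq> 0"
    using q by (auto simp: p_def norm_power power_less_one_iff)
  define R where "R = inv_qfact p"
  define Q where "Q = (\<Prod>k<2 * n. 1 - p * p ^ k)"
  define P where "P = (\<Prod>k<n. (1 + w * q * p ^ k) * (1 + q / w * p ^ k))"
  define B where "B j = Q * R (int n - j) * R (int n + j)" for j
  define f where "f j = B j * (w powi j * q powi j\<^sup>2)" for j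
  have f: "(f has_sum P) UNIV"
    using Suc unfolding f_def B_def Q_def R_def P_def p_def by simp
  have f1: "((\<lambda>j. f (j - 1)) has_sum P) UNIV"
    using f by (subst has_sum_reindex_bij_witness[of _ "\<lambda>j. j + 1" "\<lambda>j. j - 1" UNIV f]) auto
  have f2: "((\<lambda>j. f (j + 1)) has_sum P) UNIV"
    using f by (subst has_sum_reindex_bij_witness[of _ "\<lambda>j. j - 1" "\<lambda>j. j + 1" UNIV f]) auto
  define a where "a = q * p ^ n"
  have "((\<lambda>j. (1 + a\<^sup>2) * f j + a * w * f (j - 1) + a / w * f (j + 1))
      has_sum ((1 + a\<^sup>2) * P + a * w * P + a / w * P)) UNIV"
    by (intro has_sum_add has_sum_cmult_right f f1 f2)
  moreover have "(1 + a\<^sup>2) * P + a * w * P + a / w * P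
      = (\<Prod>k<Suc n. (1 + w * q * p ^ k) * (1 + q / w * p ^ k))"
    using w by (simp add: P_def a_def field_simps power2_eq_square)
  moreover have "(1 + a\<^sup>2) * f j + a * w * f (j - 1) + a / w * f (j + 1) =
      (\<Prod>k<2 * Suc n. 1 - p * p ^ k) * R (int (Suc n) - j) * R (int (Suc n) + j) * (w powi j * q powi j\<^sup>2)" for j
  proof -
    define u where "u = p powi (int (Suc n) - j)"
    define v where "v = p powi (int (Suc n) + j)"
    define X where "X = R (int (Suc n) - j)"
    define Y where "Y = R (int (Suc n) + j)"
    note pred = inv_qfact_pred[OF p(1), folded R_def]
    have R1: "R (int n - j) = (1 - u) * X" "R (int n + j) = (1 - v) * Y"
      using pred[of "int (Suc n) - j"] pred[of "int (Suc n) + j"] by (simp_all add: u_def v_def X_def Y_def)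
    have "u = p powi (int n - j) * p" "v = p powi (int n + j) * p"
      using p power_int_add[of p 1 "int n - j"] power_int_add[of p 1 "int n + j"]
      by (simp_all add: u_def v_def algebra_simps)
    then have uv': "p powi (int n - j) = u / p" "p powi (int n + j) = v / p"
      using p by simp_all
    have R2: "R (int n - (j + 1)) = (1 - u / p) * ((1 - u) * X)"
      "R (int n + (j - 1)) = (1 - v / p) * ((1 - v) * Y)"
      using pred[of "int n - j"] pred[of "int n + j"]
      by (simp_all only: R1 uv' diff_diff_eq add_diff_eq)
    have XY: "R (int n - (j - 1)) = X" "R (int n + (j + 1)) = Y"
      by (simp_all add: X_def Y_def algebra_simps)
    have B: "B j = Q * ((1 - u) * X) * ((1 - v) * Y)"
      "B (j - 1) = Q * X * ((1 - v / p) * ((1 - v) * Y))"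
      "B (j + 1) = Q * ((1 - u / p) * ((1 - u) * X)) * Y"
      by (simp_all only: B_def R1 R2 XY)
    have uv: "u * v = p ^ (2 * n + 2)"
    proof -
      have "u * v = p powi int (2 * n + 2)"
        unfolding u_def v_def using p by (simp add: algebra_simps flip: power_int_add)
      then show ?thesis by (simp only: power_int_of_nat)
    qed
    have a2: "a\<^sup>2 = u * v / p"
      unfolding uv using p by (simp add: a_def p_def power_mult_distrib power_add power_mult field_simps power2_eq_square)
    have prd: "(\<Prod>k<2 * Suc n. 1 - p * p ^ k) = Q * (1 - u * v / p) * (1 - u * v)"
      unfolding uv using p by (simp add: Q_def)
    have qu: "q powi (2 * m) = p powi m" for m
      by (simp add: p_def power_int_mult)
    have aq: "a = q powi (1 + 2 * int n)"
      using q by (simp add: a_def power_int_add qu)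
    have shift1: "a * q powi (j - 1)\<^sup>2 = u * q powi j\<^sup>2"
    proof -
      have "u = q powi (2 * (int (Suc n) - j))" by (simp only: u_def qu)
      then show ?thesis
        unfolding aq using q by (simp add: algebra_simps power2_eq_square flip: power_int_add)
    qed
    have shift2: "a * q powi (j + 1)\<^sup>2 = v * q powi j\<^sup>2"
    proof -
      have "v = q powi (2 * (int (Suc n) + j))" by (simp only: v_def qu)
      then show ?thesis
        unfolding aq using q by (simp add: algebra_simps power2_eq_square flip: power_int_add)
    qed
    have ww: "w * w powi (j - 1) = w powi j" "w powi (j + 1) / w = w powi j"
      using w by (simp_all add: power_int_add power_int_diff)
    have "a * w * f (j - 1) = B (j - 1) * (a * q powi (j - 1)\<^sup>2) * (w * w powi (j - 1))"
      by (simp add: f_def)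
    then have t1: "a * w * f (j - 1) = B (j - 1) * u * (w powi j * q powi j\<^sup>2)"
      by (simp only: shift1 ww mult_ac)
    have "a / w * f (j + 1) = B (j + 1) * (a * q powi (j + 1)\<^sup>2) * (w powi (j + 1) / w)"
      by (simp add: f_def)
    then have t2: "a / w * f (j + 1) = B (j + 1) * v * (w powi j * q powi j\<^sup>2)"
      by (simp only: shift2 ww mult_ac)
    \<comment> \<open>The three-term recurrence, once \<open>inv_qfact\<close> has been divided out.\<close>
    have key: "(1 + u * v / p) * ((1 - u) * (1 - v)) + u * ((1 - v / p) * (1 - v)) + v * ((1 - u / p) * (1 - u))
        = (1 - u * v / p) * (1 - u * v)"
      using p by (simp add: field_simps)
    have "(1 + a\<^sup>2) * f j + a * w * f (j - 1) + a / w * f (j + 1)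
        = ((1 + u * v / p) * ((1 - u) * (1 - v)) + u * ((1 - v / p) * (1 - v)) + v * ((1 - u / p) * (1 - u)))
           * (Q * X * Y * (w powi j * q powi j\<^sup>2))"
      unfolding t1 t2 B a2 f_def[of j]
      by (simp add: algebra_simps add_divide_distrib diff_divide_distrib)
    then show ?thesis
      unfolding key prd X_def[symmetric] Y_def[symmetric] by (simp only: mult_ac)
  qed
  ultimately show ?case
    by (simp only: R_def p_def)
qed

text \<open>
  The product side of the triple product identity, with the normalization in which \<open>z = 1\<close> is a zero.
\<close>
definition jtheta :: "complex \<Rightarrow> complex \<Rightarrow> complex" where
  "jtheta z q = qpoch z q * qpoch (q / z) q * qpoch q q"

lemma filterlim_nat_shift: "filterlim (\<lambda>n. nat (int n + i)) at_top sequentially"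
  unfolding filterlim_at_top
proof
  fix Z
  show "\<forall>\<^sub>F n in sequentially. Z \<le> nat (int n + i)"
    using eventually_ge_at_top[of "nat (int Z - i)"] by eventually_elim linarith
qed

text \<open>
  In the finite triple product all quotients of the finite factorials \<open>(p; p)\<^sub>m\<close> are bounded, so the
  terms are dominated by a multiple of the theta series, and the coefficients converge to
  \<open>1 / (p; p)\<^sub>\<infinity>\<close>, where \<open>p = q\<^sup>2\<close>.
\<close>
theorem jacobi_triple_product:
  assumes q: "norm q < 1" "q \<noteq> 0" and w: "w \<noteq> 0"
  shows "theta w q = jtheta (- w * q) (q\<^sup>2)"
proof -
  define p where "p = q\<^sup>2"
  have p: "norm p < 1" "p \<noteq> 0"
    using q by (auto simp: p_def norm_power power_less_one_iff)
  define Q where "Q m = (\<Prod>k<m. 1 - p * p ^ k)" for m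
  have Q_lim: "Q \<longlonglongrightarrow> qpoch p p"
    unfolding Q_def by (rule qpoch_LIMSEQ[OF p(1)])
  have Q_nz: "Q m \<noteq> 0" for m
    unfolding Q_def using one_minus_power_nonzero[OF p(1)] by simp
  have lim_nz: "qpoch p p \<noteq> 0"
    by (rule qpoch_nonzero) (use p in auto)
  obtain C1 where C1: "norm (Q m) \<le> C1" for m
    using convergent_imp_Bseq[of Q] Q_lim unfolding convergent_def Bseq_def by blast
  have inv_lim: "(\<lambda>m. 1 / Q m) \<longlonglongrightarrow> 1 / qpoch p p"
    by (intro tendsto_intros Q_lim lim_nz)
  then obtain C2 where C2: "norm (1 / Q m) \<le> C2" for m
    using convergent_imp_Bseq[of "\<lambda>m. 1 / Q m"] unfolding convergent_def Bseq_def by blast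
  have C2': "norm (inv_qfact p m) \<le> C2" for m
    using C2[of "nat m"] C2[of 0] norm_ge_zero[of "1 / Q 0"] by (auto simp: inv_qfact_def Q_def)
  have inv_qfact_lim: "(\<lambda>n. inv_qfact p (int n + i)) \<longlonglongrightarrow> 1 / qpoch p p" for i
  proof -
    have "(\<lambda>n. 1 / Q (nat (int n + i))) \<longlonglongrightarrow> 1 / qpoch p p"
      by (rule filterlim_compose[OF inv_lim filterlim_nat_shift])
    moreover have "\<forall>\<^sub>F n in sequentially. inv_qfact p (int n + i) = 1 / Q (nat (int n + i))"
      using eventually_ge_at_top[of "nat (- i)"]
      by eventually_elim (auto simp: inv_qfact_def Q_def)
    ultimately show ?thesis
      by (simp add: tendsto_cong)
  qed
  define f where "f n j = Q (2 * n) * inv_qfact p (int n - j) * inv_qfact p (int n + j) * (w powi j * q powi j\<^sup>2)"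
    for n j
  have "(\<lambda>n. \<Sum>\<^sub>\<infinity>j. f n j) \<longlonglongrightarrow> (\<Sum>\<^sub>\<infinity>j. 1 / qpoch p p * (w powi j * q powi j\<^sup>2))"
  proof (rule tendsto_infsum_dominated)
    fix j
    have "(\<lambda>n. Q (2 * n)) \<longlonglongrightarrow> qpoch p p"
      by (rule filterlim_compose[OF Q_lim]) (rule mult_nat_left_at_top, simp)
    then have "(\<lambda>n. f n j) \<longlonglongrightarrow> qpoch p p * (1 / qpoch p p) * (1 / qpoch p p) * (w powi j * q powi j\<^sup>2)"
      unfolding f_def using inv_qfact_lim[of "- j"] inv_qfact_lim[of j]
      by (intro tendsto_mult tendsto_const) auto
    then show "(\<lambda>n. f n j) \<longlonglongrightarrow> 1 / qpoch p p * (w powi j * q powi j\<^sup>2)"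
      using lim_nz by simp
  next
    fix n j
    have nonneg: "0 \<le> C1" "0 \<le> C2"
      using C1[of 0] C2[of 0] norm_ge_zero order_trans by blast+
    show "norm (f n j) \<le> C1 * C2 * C2 * norm (w powi j * q powi j\<^sup>2)"
      unfolding f_def norm_mult[of _ "w powi j * q powi j\<^sup>2"] norm_mult[of _ "inv_qfact _ _"]
      by (intro mult_right_mono mult_mono C1 C2' mult_nonneg_nonneg nonneg) auto
  next
    show "(\<lambda>j. C1 * C2 * C2 * norm (w powi j * q powi j\<^sup>2)) summable_on UNIV"
      by (intro summable_on_cmult_right theta_abs_summable q)
  qed
  moreover have "(\<Sum>\<^sub>\<infinity>j. f n j) = (\<Prod>k<n. 1 - (- w * q) * p ^ k) * (\<Prod>k<n. 1 - (p / (- w * q)) * p ^ k)" for n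
  proof -
    have "p / (- w * q) = - (q / w)"
      using q w by (simp add: p_def power2_eq_square)
    then show ?thesis
      using infsumI[OF finite_triple_product[OF q w, of n]]
      unfolding f_def Q_def p_def by (simp add: prod.distrib)
  qed
  moreover have "(\<lambda>n. (\<Prod>k<n. 1 - (- w * q) * p ^ k) * (\<Prod>k<n. 1 - (p / (- w * q)) * p ^ k))
      \<longlonglongrightarrow> qpoch (- w * q) p * qpoch (p / (- w * q)) p"
    by (intro tendsto_mult qpoch_LIMSEQ p)
  moreover have "(\<Sum>\<^sub>\<infinity>j. 1 / qpoch p p * (w powi j * q powi j\<^sup>2)) = 1 / qpoch p p * theta w q"
    unfolding theta_def by (rule infsum_cmult_right')
  ultimately have "1 / qpoch p p * theta w q = qpoch (- w * q) p * qpoch (p / (- w * q)) p"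
    using LIMSEQ_unique by fastforce
  then show ?thesis
    using lim_nz by (simp add: jtheta_def p_def field_simps)
qed

section \<open>Products of two theta functions\<close>

definition theta_term :: "complex \<Rightarrow> complex \<Rightarrow> int \<Rightarrow> complex" where
  "theta_term q w n = w powi n * q powi n\<^sup>2"

lemma has_sum_theta:
  "norm q < 1 \<Longrightarrow> (theta_term q w has_sum theta w q) UNIV"
  unfolding theta_term_def theta_def
  by (rule has_sum_infsum[OF Infinite_Sum.abs_summable_summable[OF theta_abs_summable]])

lemma has_sum_mult_theta:
  assumes "norm q < 1"
  shows "((\<lambda>(m, n). theta_term q w m * theta_term q v n) has_sum (theta w q * theta v q)) UNIV"
proof -
  have norms: "(\<lambda>n. norm (theta_term q u n)) summable_on UNIV" for u
    unfolding theta_term_def by (rule theta_abs_summable[OF assms])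
  let ?f = "\<lambda>(m, n). theta_term q w m * theta_term q v n"
  have "(\<lambda>x. norm (?f x)) summable_on (UNIV \<times> UNIV)"
    by (subst Infinite_Sum.abs_summable_on_Sigma_iff)
       (auto simp: norm_mult abs_mult infsum_cmult_right' intro!: summable_on_cmult_right summable_on_cmult_left norms)
  then have summable: "?f summable_on (UNIV \<times> UNIV)"
    by (rule Infinite_Sum.abs_summable_summable)
  have "(?f has_sum (theta w q * theta v q)) (UNIV \<times> UNIV)"
    by (rule has_sum_SigmaI[where g = "\<lambda>m. theta_term q w m * theta v q", OF _ _ summable])
       (auto intro!: has_sum_cmult_right has_sum_cmult_left has_sum_theta assms)
  then show ?thesis by simp
qed

text \<open>
  The common principle behind the product formulas: \<open>h (i, _)\<close> parametrizes the coset with index \<open>i\<close> of a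
  sublattice of \<open>\<int>\<^sup>2\<close>, and on each coset the double series is again a product of two theta series.
\<close>
lemma theta_mult_by_cosets:
  assumes q: "norm q < 1" and Q: "norm Q < 1" and I: "finite I"
    and bij: "bij_betw h (I \<times> UNIV) UNIV"
    and h: "\<And>i k l. i \<in> I \<Longrightarrow> (case h (i, k, l) of (m, n) \<Rightarrow> theta_term q w m * theta_term q v n)
              = c i * (theta_term Q (a i) k * theta_term Q (b i) l)"
  shows "theta w q * theta v q = (\<Sum>i\<in>I. c i * (theta (a i) Q * theta (b i) Q))"
proof -
  let ?f = "\<lambda>(m, n). theta_term q w m * theta_term q v n"
  have "((\<lambda>x. ?f (h x)) has_sum (theta w q * theta v q)) (I \<times> UNIV)"
    by (subst has_sum_reindex_bij_betw[OF bij]) (rule has_sum_mult_theta[OF q])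
  moreover have "((\<lambda>kl. ?f (h (i, kl))) has_sum (c i * (theta (a i) Q * theta (b i) Q))) UNIV"
    if "i \<in> I" for i
  proof -
    have "(\<lambda>kl. ?f (h (i, kl))) = (\<lambda>kl. c i * (case kl of (k, l) \<Rightarrow> theta_term Q (a i) k * theta_term Q (b i) l))"
      by (intro ext) (auto simp: h[OF that])
    then show ?thesis
      by (simp only: has_sum_cmult_right[OF has_sum_mult_theta[OF Q]])
  qed
  ultimately have "((\<lambda>i. c i * (theta (a i) Q * theta (b i) Q)) has_sum (theta w q * theta v q)) I"
    by (rule has_sum_SigmaD)
  then show ?thesis
    using has_sum_unique has_sum_finite[OF I] by blast
qed

text \<open>
  The sublattice \<open>{(m, n). even (m + n)}\<close> is parametrized by \<open>m = k - l\<close> and \<open>n = k + l\<close>, where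
  \<open>m\<^sup>2 + n\<^sup>2 = 2 (k\<^sup>2 + l\<^sup>2)\<close>.
\<close>
lemma theta_mult_2:
  assumes q: "norm q < 1" "q \<noteq> 0" and w: "w \<noteq> 0" and v: "v \<noteq> 0"
  shows "theta w q * theta v q = theta (w * v) (q\<^sup>2) * theta (v / w) (q\<^sup>2)
    + w * q * (theta (w * v * q\<^sup>2) (q\<^sup>2) * theta (v / (w * q\<^sup>2)) (q\<^sup>2))"
proof -
  define h :: "int \<times> int \<times> int \<Rightarrow> int \<times> int" where "h = (\<lambda>(r, k, l). (k - l + r, k + l))"
  have "theta w q * theta v q = (\<Sum>r\<in>{0, 1::int}. (w * q) powi r *
      (theta (w * v * q powi (2 * r)) (q\<^sup>2) * theta (v / (w * q powi (2 * r))) (q\<^sup>2)))"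
  proof (rule theta_mult_by_cosets[where h = h])
    show "bij_betw h ({0, 1} \<times> UNIV) UNIV"
      by (rule bij_betw_byWitness[where f' = "\<lambda>(m, n). ((m + n) mod 2, (m + n) div 2, n - (m + n) div 2)"])
         (auto simp: h_def; presburger)+
  next
    fix r k l :: int
    assume r: "r \<in> {0, 1}"
    have e: "q powi (k - l + r)\<^sup>2 * q powi (k + l)\<^sup>2
        = q powi r * (q powi (2 * r)) powi k * (q\<^sup>2) powi k\<^sup>2 * (inverse (q powi (2 * r)) powi l * (q\<^sup>2) powi l\<^sup>2)"
    proof -
      have "q powi (k - l + r)\<^sup>2 * q powi (k + l)\<^sup>2 = q powi (r + 2 * r * k + 2 * k\<^sup>2 + (- (2 * r * l) + 2 * l\<^sup>2))"
        using q r by (auto simp flip: power_int_add simp: power2_eq_square algebra_simps)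
      also have "\<dots> = q powi r * (q powi (2 * r)) powi k * (q\<^sup>2) powi k\<^sup>2 * (inverse (q powi (2 * r)) powi l * (q\<^sup>2) powi l\<^sup>2)"
        using q by (simp add: power_int_add power_int_mult power_int_minus power_int_inverse power_int_diff divide_inverse)
      finally show ?thesis .
    qed
    have ew: "w powi (k - l + r) * v powi (k + l) = w powi r * (w * v) powi k * (v / w) powi l"
      using w v by (simp add: power_int_add power_int_diff power_int_mult_distrib power_int_divide_distrib)
    have "(case h (r, k, l) of (m, n) \<Rightarrow> theta_term q w m * theta_term q v n)
        = (w powi (k - l + r) * v powi (k + l)) * (q powi (k - l + r)\<^sup>2 * q powi (k + l)\<^sup>2)"
      by (simp add: h_def theta_term_def mult_ac)
    also have "\<dots> = (w * q) powi r * (theta_term (q\<^sup>2) (w * v * q powi (2 * r)) k * theta_term (q\<^sup>2) (v / (w * q powi (2 * r))) l)"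
      unfolding e ew theta_term_def
      by (simp add: power_int_mult_distrib power_int_divide_distrib power_int_inverse divide_inverse mult_ac)
    finally show "(case h (r, k, l) of (m, n) \<Rightarrow> theta_term q w m * theta_term q v n)
        = (w * q) powi r * (theta_term (q\<^sup>2) (w * v * q powi (2 * r)) k * theta_term (q\<^sup>2) (v / (w * q powi (2 * r))) l)" .
  qed (use q in \<open>auto simp: norm_power power_less_one_iff\<close>)
  then show ?thesis by simp
qed

text \<open>
  The sublattice \<open>{(m, n). 5 dvd 2 m + n}\<close> is parametrized by \<open>m = 2 k + l\<close> and \<open>n = k - 2 l\<close>, where
  \<open>m\<^sup>2 + n\<^sup>2 = 5 (k\<^sup>2 + l\<^sup>2)\<close>; the cosets are represented by \<open>(0, s)\<close>.
\<close>
lemma theta_mult_5: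
  assumes q: "norm q < 1" "q \<noteq> 0" and w: "w \<noteq> 0" and v: "v \<noteq> 0"
  shows "theta w q * theta v q = (\<Sum>s\<in>{0..4::int}. v powi s * q powi s\<^sup>2 *
      (theta (w\<^sup>2 * v * q powi (2 * s)) (q ^ 5) * theta (w / (v\<^sup>2 * q powi (4 * s))) (q ^ 5)))"
proof -
  define h :: "int \<times> int \<times> int \<Rightarrow> int \<times> int" where "h = (\<lambda>(s, k, l). (2 * k + l, k - 2 * l + s))"
  show ?thesis
  proof (rule theta_mult_by_cosets[where h = h])
    show "bij_betw h ({0..4} \<times> UNIV) UNIV"
      by (rule bij_betw_byWitness[where f' = "\<lambda>(m, n).
            ((2 * m + n) mod 5, (2 * m + n) div 5, m - 2 * ((2 * m + n) div 5))"])
         (auto simp: h_def; presburger)+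
  next
    fix s k l :: int
    have e: "q powi (2 * k + l)\<^sup>2 * q powi (k - 2 * l + s)\<^sup>2
        = q powi s\<^sup>2 * (q powi (2 * s)) powi k * (q ^ 5) powi k\<^sup>2 * (inverse (q powi (4 * s)) powi l * (q ^ 5) powi l\<^sup>2)"
    proof -
      have "q powi (2 * k + l)\<^sup>2 * q powi (k - 2 * l + s)\<^sup>2
          = q powi (s\<^sup>2 + 2 * s * k + 5 * k\<^sup>2 + (- (4 * s * l) + 5 * l\<^sup>2))"
        using q by (simp flip: power_int_add add: power2_eq_square algebra_simps)
      also have "\<dots> = q powi s\<^sup>2 * (q powi (2 * s)) powi k * (q ^ 5) powi k\<^sup>2 * (inverse (q powi (4 * s)) powi l * (q ^ 5) powi l\<^sup>2)"
        using q by (simp add: power_int_add power_int_mult power_int_minus power_int_inverse power_int_diff divide_inverse)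
      finally show ?thesis .
    qed
    have ew: "w powi (2 * k + l) * v powi (k - 2 * l + s) = v powi s * (w\<^sup>2 * v) powi k * (w / v\<^sup>2) powi l"
      using w v by (simp add: power_int_add power_int_diff power_int_mult power_int_mult_distrib power_int_divide_distrib)
    have "(case h (s, k, l) of (m, n) \<Rightarrow> theta_term q w m * theta_term q v n)
        = (w powi (2 * k + l) * v powi (k - 2 * l + s)) * (q powi (2 * k + l)\<^sup>2 * q powi (k - 2 * l + s)\<^sup>2)"
      by (simp add: h_def theta_term_def mult_ac)
    also have "\<dots> = v powi s * q powi s\<^sup>2 * (theta_term (q ^ 5) (w\<^sup>2 * v * q powi (2 * s)) k
            * theta_term (q ^ 5) (w / (v\<^sup>2 * q powi (4 * s))) l)"
      unfolding e ew theta_term_def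
      by (simp add: power_int_mult_distrib power_int_divide_distrib power_int_inverse divide_inverse mult_ac)
    finally show "(case h (s, k, l) of (m, n) \<Rightarrow> theta_term q w m * theta_term q v n)
        = v powi s * q powi s\<^sup>2 * (theta_term (q ^ 5) (w\<^sup>2 * v * q powi (2 * s)) k
            * theta_term (q ^ 5) (w / (v\<^sup>2 * q powi (4 * s))) l)" .
  qed (use q in \<open>auto simp: norm_power power_less_one_iff\<close>)
qed

text \<open>
  The triple product has base \<open>p\<^sup>2\<close>, so the factors on the left are theta series in a square root
  \<open>p\<close> of \<open>q\<close>. No root survives in the result.
\<close>
lemma jtheta_mult:
  assumes q: "norm q < 1" "q \<noteq> 0" and x: "x \<noteq> 0" and y: "y \<noteq> 0"
  shows "jtheta x q * jtheta y q = jtheta (- (x * y)) (q\<^sup>2) * jtheta (- (q * y / x)) (q\<^sup>2)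
    - x * (jtheta (- (q * x * y)) (q\<^sup>2) * jtheta (- (y / x)) (q\<^sup>2))"
proof -
  obtain p where p: "q = p\<^sup>2"
    using power2_csqrt by metis
  have p': "norm p < 1" "p \<noteq> 0"
    using q by (auto simp: p norm_power power_less_one_iff)
  have J: "jtheta u q = theta (- (u / p)) p" if "u \<noteq> 0" for u
    using jacobi_triple_product[OF p', of "- (u / p)"] that p' by (simp add: p)
  have J2: "theta u q = jtheta (- (u * q)) (q\<^sup>2)" if "u \<noteq> 0" for u
    using jacobi_triple_product[OF q that] by simp
  have "jtheta x q * jtheta y q = theta (x * y / p\<^sup>2) q * theta (y / x) q
      - x * (theta (x * y) q * theta (y / (x * q)) q)"
    unfolding J[OF x] J[OF y] using theta_mult_2[OF p', of "- (x / p)" "- (y / p)"] p' x y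
    by (simp add: p power2_eq_square mult_ac)
  also have "theta (x * y / p\<^sup>2) q = jtheta (- (x * y)) (q\<^sup>2)"
    using x y p' by (subst J2) (auto simp: p)
  also have "theta (y / x) q = jtheta (- (q * y / x)) (q\<^sup>2)"
    using x y by (subst J2) (auto simp: mult_ac)
  also have "theta (x * y) q = jtheta (- (q * x * y)) (q\<^sup>2)"
    using x y by (subst J2) (auto simp: mult_ac)
  also have "theta (y / (x * q)) q = jtheta (- (y / x)) (q\<^sup>2)"
    using x y q by (subst J2) auto
  finally show ?thesis .
qed

lemma jtheta_mult_5:
  assumes q: "norm q < 1" "q \<noteq> 0" and x: "x \<noteq> 0" and y: "y \<noteq> 0"
  shows "jtheta x (q\<^sup>2) * jtheta y (q\<^sup>2) = (\<Sum>s\<in>{0..4}. (- y) powi s * q powi (s\<^sup>2 - s) *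
      (jtheta (x\<^sup>2 * y * q powi (2 + 2 * s)) (q ^ 10) * jtheta (x / y\<^sup>2 * q powi (6 - 4 * s)) (q ^ 10)))"
proof -
  have J: "jtheta u (q\<^sup>2) = theta (- (u / q)) q" if "u \<noteq> 0" for u
    using jacobi_triple_product[OF q, of "- (u / q)"] that q by simp
  have q5: "norm (q ^ 5) < 1" "q ^ 5 \<noteq> 0"
    using q by (auto simp: norm_power power_less_one_iff)
  have J5: "theta u (q ^ 5) = jtheta (- (u * q ^ 5)) (q ^ 10)" if "u \<noteq> 0" for u
    using jacobi_triple_product[OF q5 that] by (simp flip: power_mult)
  show ?thesis
    unfolding J[OF x] J[OF y]
  proof (subst theta_mult_5[OF q], goal_cases)
    case 3
    show ?case
    proof (rule sum.cong[OF refl])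
      fix s :: int
      have "(- (y / q)) powi s * q powi s\<^sup>2 = (- y) powi s * q powi (s\<^sup>2 - s)"
        using q power_int_divide_distrib[of "- y" q s] by (simp add: power_int_diff)
      moreover have "theta ((- (x / q))\<^sup>2 * - (y / q) * q powi (2 * s)) (q ^ 5)
          = jtheta (x\<^sup>2 * y * q powi (2 + 2 * s)) (q ^ 10)"
        using x y q by (subst J5) (auto simp: power_int_add power_divide eval_nat_numeral mult_ac)
      moreover have "theta (- (x / q) / ((- (y / q))\<^sup>2 * q powi (4 * s))) (q ^ 5)
          = jtheta (x / y\<^sup>2 * q powi (6 - 4 * s)) (q ^ 10)"
        using x y q by (subst J5) (auto simp: power_int_diff power_divide eval_nat_numeral mult_ac)
      ultimately show "(- (y / q)) powi s * q powi s\<^sup>2 *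
           (theta ((- (x / q))\<^sup>2 * - (y / q) * q powi (2 * s)) (q ^ 5) *
            theta (- (x / q) / ((- (y / q))\<^sup>2 * q powi (4 * s))) (q ^ 5)) =
          (- y) powi s * q powi (s\<^sup>2 - s) *
           (jtheta (x\<^sup>2 * y * q powi (2 + 2 * s)) (q ^ 10) * jtheta (x / y\<^sup>2 * q powi (6 - 4 * s)) (q ^ 10))"
        by simp
    qed
  qed (use x y q in auto)
qed

text \<open>
  Moving one factor from each of the products \<open>(z; q)\<^sub>\<infinity>\<close> and \<open>(q/z; q)\<^sub>\<infinity>\<close> to the other one.
\<close>
lemma jtheta_shift:
  assumes "norm q < 1" "q \<noteq> 0" "z \<noteq> 0"
  shows "jtheta (q * z) q = - jtheta z q / z"
proof -
  have e1: "qpoch z q = (1 - z) * qpoch (q * z) q"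
    using qpoch_rec[OF assms(1), of z] by (simp add: mult.commute)
  have e2: "qpoch (1 / z) q = (1 - 1 / z) * qpoch (q / z) q"
    using qpoch_rec[OF assms(1), of "1 / z"] by simp
  have e3: "q / (q * z) = 1 / z"
    using assms(2) by simp
  show ?thesis
    unfolding jtheta_def e3 e1 e2 using assms(3) by (simp add: algebra_simps diff_divide_distrib)
qed

lemma jtheta_reflect:
  assumes "q \<noteq> 0" "z \<noteq> 0"
  shows "jtheta (q / z) q = jtheta z q"
  using assms by (simp add: jtheta_def)

lemma jtheta_inverse:
  assumes "norm q < 1" "q \<noteq> 0" "z \<noteq> 0"
  shows "jtheta (1 / z) q = - jtheta z q / z"
  using jtheta_shift[OF assms] jtheta_reflect[of q "1 / z"] assms by simp

section \<open>Theta functions at signed powers of one variable\<close>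

text \<open>
  From here on every theta function is taken at \<open>\<plusminus>q\<^sup>n\<close> with a power of \<open>q\<close> as its base. Recording only
  the sign and the two exponents reduces the bookkeeping to arithmetic of numerals.
\<close>
definition qpoch_monomial :: "complex \<Rightarrow> complex \<Rightarrow> nat \<Rightarrow> nat \<Rightarrow> complex" where
  "qpoch_monomial q s n m = qpoch (s * q ^ n) (q ^ m)"

definition jtheta_monomial :: "complex \<Rightarrow> complex \<Rightarrow> nat \<Rightarrow> nat \<Rightarrow> complex" where
  "jtheta_monomial q s n m = jtheta (s * q ^ n) (q ^ m)"

lemma norm_power_less_one:
  fixes q :: complex
  shows "norm q < 1 \<Longrightarrow> m > 0 \<Longrightarrow> norm (q ^ m) < 1"
  by (simp add: norm_power power_less_one_iff)

lemma qpoch_monomial_nonzero: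
  assumes "norm q < 1" "norm s = 1" "n > 0" "m > 0"
  shows "qpoch_monomial q s n m \<noteq> 0"
  unfolding qpoch_monomial_def
  using norm_power_less_one[OF assms(1,3)] norm_power_less_one[OF assms(1,4)] assms(2)
  by (intro qpoch_nonzero) (simp_all add: norm_mult)

lemma qpoch_monomial_multisection:
  assumes "norm q < 1" "m > 0" "k > 0"
  shows "qpoch_monomial q s n m = (\<Prod>i<k. qpoch_monomial q s (n + m * i) (m * k))"
  unfolding qpoch_monomial_def
  using qpoch_multisection[OF norm_power_less_one[OF assms(1,2)] assms(3), of "s * q ^ n"]
  by (simp add: power_add power_mult mult.assoc)

lemma qpoch_monomial_mult_minus:
  assumes "norm q < 1" "m > 0"
  shows "qpoch_monomial q s n m * qpoch_monomial q (- s) n m = qpoch_monomial q (s\<^sup>2) (2 * n) (2 * m)"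
  unfolding qpoch_monomial_def
  using qpoch_mult_minus[OF norm_power_less_one[OF assms], of "s * q ^ n"]
  by (simp add: power_mult_distrib mult.commute[of 2] power_mult)

lemma sign_square_cases:
  fixes s :: complex
  assumes "s\<^sup>2 = 1"
  obtains "s = 1" | "s = -1"
  using assms power2_eq_1_iff by blast

lemma jtheta_monomial_eq_poch:
  assumes "q \<noteq> 0" "s\<^sup>2 = 1" "n \<le> m"
  shows "jtheta_monomial q s n m = qpoch_monomial q s n m * qpoch_monomial q s (m - n) m * qpoch_monomial q 1 m m"
proof -
  have "q ^ m / (s * q ^ n) = s * q ^ (m - n)"
    using assms(1,3) by (cases rule: sign_square_cases[OF assms(2)]) (auto simp: power_diff)
  then show ?thesis
    by (simp add: jtheta_monomial_def qpoch_monomial_def jtheta_def)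
qed

lemma jtheta_monomial_reflect:
  assumes "q \<noteq> 0" "s\<^sup>2 = 1" "n \<le> m"
  shows "jtheta_monomial q s (m - n) m = jtheta_monomial q s n m"
  using assms by (simp add: jtheta_monomial_eq_poch)

lemma jtheta_monomial_shift:
  assumes "norm q < 1" "q \<noteq> 0" "s\<^sup>2 = 1" "m > 0"
  shows "jtheta_monomial q s (m + n) m = - s * jtheta_monomial q s n m / q ^ n"
  unfolding jtheta_monomial_def
  using jtheta_shift[OF norm_power_less_one[OF assms(1,4)], of "s * q ^ n"] assms(2)
  by (cases rule: sign_square_cases[OF assms(3)]) (auto simp: power_add)

text \<open>
  The index-two product formula for monomials. As \<open>s\<close> and \<open>t\<close> are signs, \<open>t / s = s t\<close>, so all four theta
  functions on the right carry the same sign.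
\<close>
lemma jtheta_monomial_mult:
  assumes "norm q < 1" "q \<noteq> 0" "m > 0" and s: "s\<^sup>2 = 1" and t: "t\<^sup>2 = 1" and ab: "a \<le> b"
  shows "jtheta_monomial q s a m * jtheta_monomial q t b m =
      jtheta_monomial q (- (s * t)) (a + b) (2 * m) * jtheta_monomial q (- (s * t)) (m + b - a) (2 * m)
      - s * q ^ a * (jtheta_monomial q (- (s * t)) (m + a + b) (2 * m) * jtheta_monomial q (- (s * t)) (b - a) (2 * m))"
proof -
  have nz: "s * q ^ a \<noteq> 0" "t * q ^ b \<noteq> 0" "q ^ m \<noteq> 0"
    using assms by auto
  have e: "- (s * q ^ a * (t * q ^ b)) = - (s * t) * q ^ (a + b)"
    "- (q ^ m * (t * q ^ b) / (s * q ^ a)) = - (s * t) * q ^ (m + b - a)"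
    "- (q ^ m * (s * q ^ a) * (t * q ^ b)) = - (s * t) * q ^ (m + a + b)"
    "- (t * q ^ b / (s * q ^ a)) = - (s * t) * q ^ (b - a)"
    "(q ^ m)\<^sup>2 = q ^ (2 * m)"
    using assms(2) ab
    by (cases rule: sign_square_cases[OF s]; cases rule: sign_square_cases[OF t];
        simp add: power_add power_diff mult.commute[of 2] power_mult)+
  show ?thesis
    unfolding jtheta_monomial_def
    using jtheta_mult[OF norm_power_less_one[OF assms(1,3)] nz(3,1,2)] unfolding e by simp
qed

context
  fixes q :: complex
  assumes q: "norm q < 1" "q \<noteq> 0"
begin

lemma split_poch_2:
  "m > 0 \<Longrightarrow> qpoch_monomial q s n m = qpoch_monomial q s n (2 * m) * qpoch_monomial q s (n + m) (2 * m)"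
  using qpoch_monomial_multisection[OF q(1), of m 2 s n] by (simp add: numeral_2_eq_2 lessThan_Suc mult_ac)

lemma split_poch_5:
  "m > 0 \<Longrightarrow> qpoch_monomial q s n m = qpoch_monomial q s n (5 * m)
      * qpoch_monomial q s (n + m) (5 * m) * qpoch_monomial q s (n + 2 * m) (5 * m)
      * qpoch_monomial q s (n + 3 * m) (5 * m) * qpoch_monomial q s (n + 4 * m) (5 * m)"
  using qpoch_monomial_multisection[OF q(1), of m 5 s n]
  by (simp add: eval_nat_numeral lessThan_Suc algebra_simps)

text \<open>
  Euler's identity \<open>(x; x\<^sup>2)\<^sub>\<infinity> (-x; x\<^sup>2)\<^sub>\<infinity> (-x\<^sup>2; x\<^sup>2)\<^sub>\<infinity> = 1\<close> at \<open>x = q\<^sup>m\<close>: multiplying by \<open>(x\<^sup>2; x\<^sup>2)\<^sub>\<infinity>\<close>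
  reproduces \<open>(x\<^sup>2; x\<^sup>2)\<^sub>\<infinity>\<close>.
\<close>
lemma euler_product:
  assumes "m > 0"
  shows "qpoch_monomial q 1 m (2 * m) * qpoch_monomial q (-1) m (2 * m) * qpoch_monomial q (-1) (2 * m) (2 * m) = 1"
proof -
  have "qpoch_monomial q 1 (2 * m) (2 * m) * (qpoch_monomial q 1 m (2 * m)
      * qpoch_monomial q (-1) m (2 * m) * qpoch_monomial q (-1) (2 * m) (2 * m))
      = qpoch_monomial q 1 (2 * m) (2 * m)"
    using qpoch_monomial_mult_minus[OF q(1), of "2 * m" 1 m] qpoch_monomial_mult_minus[OF q(1), of "2 * m" 1 "2 * m"]
      split_poch_2[of "2 * m" 1 "2 * m"] assms
    by (simp add: mult_ac)
  moreover have "qpoch_monomial q 1 (2 * m) (2 * m) \<noteq> 0"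
    using assms q by (intro qpoch_monomial_nonzero) auto
  ultimately show ?thesis by simp
qed

lemma theta_mod5_factor:
  assumes "n \<le> 5" "s\<^sup>2 = 1"
  shows "jtheta_monomial q s n 5 * (qpoch_monomial q 1 10 10)\<^sup>2
    = qpoch_monomial q 1 5 5 * (jtheta_monomial q s n 10 * jtheta_monomial q s (5 + n) 10)"
proof -
  have "5 - n + 5 = 10 - n" "10 - (5 + n) = 5 - n" "n \<le> 10" "5 + n \<le> 10" using assms by auto
  then show ?thesis
    using assms(2,1) split_poch_2[of 5 s n] split_poch_2[of 5 s "5 - n"] q
    by (simp add: jtheta_monomial_eq_poch power2_eq_square mult_ac add.commute)
qed

lemma theta_mod5_double:
  assumes "n \<le> 5"
  shows "jtheta_monomial q 1 (2 * n) 10 * (qpoch_monomial q 1 5 5)\<^sup>2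
    = jtheta_monomial q 1 n 5 * jtheta_monomial q (-1) n 5 * qpoch_monomial q 1 10 10"
  using assms q qpoch_monomial_mult_minus[OF q(1), of 5 1 n] qpoch_monomial_mult_minus[OF q(1), of 5 1 "5 - n"]
  by (simp add: jtheta_monomial_eq_poch power2_eq_square mult_ac diff_mult_distrib2)

end

lemma jtheta_monomial_neg:
  assumes "norm q < 1" "q \<noteq> 0" "s\<^sup>2 = 1" "m > 0"
  shows "jtheta (s / q ^ n) (q ^ m) = - s * jtheta_monomial q s n m / q ^ n"
proof -
  have "s / q ^ n = 1 / (s * q ^ n)"
    by (cases rule: sign_square_cases[OF assms(3)]) auto
  then show ?thesis
    using jtheta_inverse[OF norm_power_less_one[OF assms(1,4)], of "s * q ^ n"] assms(2)
    by (cases rule: sign_square_cases[OF assms(3)]) (auto simp: jtheta_monomial_def)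
qed

lemma jtheta_monomial_self:
  assumes "norm q < 1" "q \<noteq> 0" "m > 0"
  shows "jtheta_monomial q 1 m m = 0"
proof -
  have "qpoch_monomial q 1 0 m = 0"
    unfolding qpoch_monomial_def using norm_power_less_one[OF assms(1,3)] qpoch_eq_0_iff[of "q ^ m" 1]
    by (auto intro!: exI[of _ 0])
  then show ?thesis
    using assms by (simp add: jtheta_monomial_eq_poch)
qed

section \<open>Theta identities modulo five\<close>

context
  fixes q :: complex
  assumes q: "norm q < 1" "q \<noteq> 0"
begin

text \<open>
  The theta functions below have modulus \<open>5\<close> (\<open>J\<close>), \<open>10\<close> (\<open>j\<close>, and \<open>b\<close> with a negative argument), or
  \<open>20\<close> (\<open>k\<close>); \<open>\<phi>\<close> is \<open>T (-1) 1 2\<close> and \<open>\<psi>\<close> is \<open>T (-1) 0 2\<close>.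
\<close>
private abbreviation T where "T \<equiv> jtheta_monomial q"
private abbreviation P where "P \<equiv> qpoch_monomial q"
private abbreviation j where "j n \<equiv> jtheta_monomial q 1 n 10"
private abbreviation b where "b n \<equiv> jtheta_monomial q (-1) n 10"
private abbreviation k where "k n \<equiv> jtheta_monomial q 1 n 20"
private abbreviation J where "J n \<equiv> jtheta_monomial q 1 n 5"
private abbreviation euler where "euler n \<equiv> qpoch_monomial q 1 n n"

lemma jtheta_monomial_nonzero:
  assumes "s\<^sup>2 = 1" "0 < n" "n < m"
  shows "T s n m \<noteq> 0"
proof -
  have "norm s = 1"
    using assms(1) by (metis norm_one norm_power power2_eq_1_iff norm_minus_cancel)
  then show ?thesis
    using assms q by (simp add: jtheta_monomial_eq_poch qpoch_monomial_nonzero)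
qed

private lemmas reflections =
  jtheta_monomial_reflect[OF q(2), of 1 4 10, simplified] jtheta_monomial_reflect[OF q(2), of 1 3 10, simplified]
  jtheta_monomial_reflect[OF q(2), of "-1" 1 10, simplified] jtheta_monomial_reflect[OF q(2), of "-1" 2 10, simplified]
  jtheta_monomial_reflect[OF q(2), of "-1" 3 10, simplified] jtheta_monomial_reflect[OF q(2), of "-1" 4 10, simplified]
  jtheta_monomial_reflect[OF q(2), of 1 1 20, simplified] jtheta_monomial_reflect[OF q(2), of 1 3 20, simplified]
  jtheta_monomial_reflect[OF q(2), of 1 5 20, simplified] jtheta_monomial_reflect[OF q(2), of 1 6 20, simplified]
  jtheta_monomial_reflect[OF q(2), of 1 7 20, simplified] jtheta_monomial_reflect[OF q(2), of 1 8 20, simplified]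
  jtheta_monomial_reflect[OF q(2), of 1 9 20, simplified]

text \<open>
  The vector \<open>(J\<^sub>2\<^sup>2, J\<^sub>1 J\<^sub>2, J\<^sub>1\<^sup>2)\<close> is the cross product of \<open>(b\<^sub>3, -b\<^sub>5, -q b\<^sub>1)\<close> and
  \<open>(b\<^sub>2, -q b\<^sub>0, -b\<^sub>4)\<close>. Hence it is orthogonal to both of them, which is how \<open>b\<^sub>5\<close> and \<open>b\<^sub>0\<close> are
  eliminated in \<open>mod5_squares\<close>.
\<close>
private lemma mod5_products:
  shows J2_sq: "(J 2)\<^sup>2 = b 4 * b 5 - q\<^sup>2 * (b 1 * b 0)"
    and J1_sq: "(J 1)\<^sup>2 = b 2 * b 5 - q * (b 3 * b 0)"
    and J1_J2: "J 1 * J 2 = b 3 * b 4 - q * (b 1 * b 2)"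
  using jtheta_monomial_mult[OF q, of 5 1 1 2 2] jtheta_monomial_mult[OF q, of 5 1 1 1 1]
    jtheta_monomial_mult[OF q, of 5 1 1 1 2]
  by (simp_all add: reflections power2_eq_square mult_ac numeral_2_eq_2[symmetric])

private lemma mod10_products:
  shows "j 3 * b 4 = k 7 * k 9 - q ^ 3 * (k 3 * k 1)"
    and "j 1 * b 2 = k 3 * k 9 - q * (k 7 * k 1)"
    and "b 1 * j 4 = k 5 * k 7 + q * (k 5 * k 3)"
    and "b 3 * j 2 = k 5 * k 9 - q\<^sup>2 * (k 5 * k 1)"
    and "j 3 * b 1 = k 4 * k 8 + q * (k 6 * k 2)"
    and "j 1 * b 3 = k 4 * k 8 - q * (k 6 * k 2)"
  using jtheta_monomial_mult[OF q, of 10 1 "-1" 3 4] jtheta_monomial_mult[OF q, of 10 1 "-1" 1 2]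
    jtheta_monomial_mult[OF q, of 10 "-1" 1 1 4] jtheta_monomial_mult[OF q, of 10 1 "-1" 2 3]
    jtheta_monomial_mult[OF q, of 10 "-1" 1 1 3] jtheta_monomial_mult[OF q, of 10 1 "-1" 1 3]
  by (simp_all add: reflections mult_ac numeral_2_eq_2[symmetric])

text \<open>
  Both sides equal \<open>k\<^sub>5\<^sup>2 (k\<^sub>7 + q k\<^sub>3) (k\<^sub>9 - q\<^sup>2 k\<^sub>1)\<close>.
\<close>
private lemma factor_sum: "(k 5)\<^sup>2 * (j 3 * b 4 + q * (j 1 * b 2)) = b 1 * j 4 * (b 3 * j 2)"
  unfolding mod10_products by (simp add: power2_eq_square power3_eq_cube algebra_simps)

private lemma sum_mod20: "j 3 * b 1 + j 1 * b 3 = 2 * (k 4 * k 8)"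
  unfolding mod10_products by simp

text \<open>
  A product of theta functions over a complete set of exponents is an infinite product of lower level:
  for instance \<open>1, 3, 5, 7, 9\<close> are the odd residues modulo ten.
\<close>
private lemma
  shows j13: "j 1 * j 3 * P 1 5 10 = (euler 10)\<^sup>2 * P 1 1 2"
    and b13: "b 1 * b 3 * P (-1) 5 10 = (euler 10)\<^sup>2 * P (-1) 1 2"
    and j24: "j 2 * j 4 = euler 10 * euler 2"
    and b24: "b 2 * b 4 * P (-1) 10 10 = (euler 10)\<^sup>2 * P (-1) 2 2"
    and k48: "k 4 * k 8 = euler 20 * euler 4"
    and k5: "k 5 = P 1 5 10 * euler 20"
  using split_poch_5[OF q, of 2 1 1] split_poch_5[OF q, of 2 "-1" 1] split_poch_5[OF q, of 2 1 2]
    split_poch_5[OF q, of 2 "-1" 2] split_poch_5[OF q, of 4 1 4] split_poch_2[OF q, of 10 1 5] q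
  by (simp_all add: jtheta_monomial_eq_poch power2_eq_square mult_ac numeral_2_eq_2[symmetric])

private lemma phi_poch: "T (-1) 1 2 = (P (-1) 1 2)\<^sup>2 * euler 2"
  using q by (simp add: jtheta_monomial_eq_poch power2_eq_square)

private lemma psi_poch: "T (-1) 0 2 = 2 * (P (-1) 2 2)\<^sup>2 * euler 2"
proof -
  have "P (-1) 0 2 = 2 * P (-1) 2 2"
    using qpoch_rec[OF norm_power_less_one[OF q(1), of 2], of "-1"] by (simp add: qpoch_monomial_def)
  then show ?thesis
    using q by (simp add: jtheta_monomial_eq_poch power2_eq_square)
qed

private lemma euler_double: "n > 0 \<Longrightarrow> euler (2 * n) = euler n * P (-1) n n"
  using qpoch_monomial_mult_minus[OF q(1), of n 1 n] by simp

private lemma euler_nonzero: "n > 0 \<Longrightarrow> euler n \<noteq> 0"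
  using q by (intro qpoch_monomial_nonzero) auto

text \<open>
  After multiplication by \<open>(-q\<^sup>5; q\<^sup>1\<^sup>0)\<^sub>\<infinity>\<close>, both sides equal \<open>E\<^sub>1\<^sub>0\<^sup>6 E\<^sub>2 (-q; q\<^sup>2)\<^sub>\<infinity>\<close> by Euler's
  identity, used for \<open>q\<close> and for \<open>q\<^sup>5\<close>.
\<close>
private lemma phi_mod10:
  "(euler 10) ^ 3 * (j 2 * j 4) * (b 1 * b 3) = T (-1) 1 2 * (k 5)\<^sup>2 * (j 1 * j 3) * (b 2 * b 4)"
proof -
  define t t' u v o1 o2 where defs: "t = P 1 5 10" "t' = P (-1) 5 10" "u = P (-1) 2 2" "v = P (-1) 10 10"
    "o1 = P 1 1 2" "o2 = P (-1) 1 2"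
  have eul: "o1 * o2 * u = 1" "t * t' * v = 1"
    unfolding defs using euler_product[OF q, of 1] euler_product[OF q, of 5] by simp_all
  have euler20: "euler 20 = euler 10 * v"
    using euler_double[of 10] by (simp add: defs)
  have "T (-1) 1 2 * (k 5)\<^sup>2 * (j 1 * j 3) * (b 2 * b 4) * t'
      = o2\<^sup>2 * euler 2 * (euler 10)\<^sup>2 * (t * t' * v) * (j 1 * j 3 * t) * (b 2 * b 4 * v)"
    unfolding phi_poch k5 euler20 defs[symmetric] by (simp add: power2_eq_square mult_ac)
  also have "\<dots> = o2\<^sup>2 * euler 2 * (euler 10)\<^sup>2 * ((euler 10)\<^sup>2 * o1) * ((euler 10)\<^sup>2 * u)"
    unfolding eul using j13 b24 by (simp add: defs)
  also have "\<dots> = (euler 10) ^ 6 * euler 2 * o2 * (o1 * o2 * u)"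
    by (simp add: eval_nat_numeral mult_ac)
  also have "\<dots> = (euler 10) ^ 3 * (euler 10 * euler 2) * ((euler 10)\<^sup>2 * o2)"
    unfolding eul by (simp add: eval_nat_numeral mult_ac)
  also have "\<dots> = (euler 10) ^ 3 * (j 2 * j 4) * (b 1 * b 3) * t'"
    unfolding j24 using b13 by (simp add: defs mult.assoc)
  finally show ?thesis
    using qpoch_monomial_nonzero[OF q(1), of "-1" 5 10] by (simp add: defs)
qed

private lemma psi_mod10:
  "2 * (euler 10) ^ 3 * (k 4 * k 8) = T (-1) 0 2 * (j 1 * j 3) * (b 1 * b 3)"
proof -
  define t t' u v o1 o2 where defs: "t = P 1 5 10" "t' = P (-1) 5 10" "u = P (-1) 2 2" "v = P (-1) 10 10"
    "o1 = P 1 1 2" "o2 = P (-1) 1 2"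
  have eul: "o1 * o2 * u = 1" "t * t' * v = 1"
    unfolding defs using euler_product[OF q, of 1] euler_product[OF q, of 5] by simp_all
  have euler20: "euler 20 = euler 10 * v" and euler4: "euler 4 = euler 2 * u"
    using euler_double[of 10] euler_double[of 2] by (simp_all add: defs)
  have "T (-1) 0 2 * (j 1 * j 3) * (b 1 * b 3) * (t * t')
      = 2 * u\<^sup>2 * euler 2 * (j 1 * j 3 * t) * (b 1 * b 3 * t')"
    unfolding psi_poch defs[symmetric] by (simp add: power2_eq_square mult_ac)
  also have "\<dots> = 2 * u\<^sup>2 * euler 2 * ((euler 10)\<^sup>2 * o1) * ((euler 10)\<^sup>2 * o2)"
    using j13 b13 by (simp add: defs)
  also have "\<dots> = 2 * (euler 10) ^ 4 * (euler 2 * u) * (o1 * o2 * u)"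
    by (simp add: eval_nat_numeral mult_ac)
  also have "\<dots> = 2 * (euler 10) ^ 4 * (euler 2 * u) * (t * t' * v)"
    unfolding eul ..
  also have "\<dots> = 2 * (euler 10) ^ 3 * (k 4 * k 8) * (t * t')"
    unfolding k48 euler20 euler4 by (simp add: eval_nat_numeral mult_ac)
  finally show ?thesis
    using qpoch_monomial_nonzero[OF q(1), of "-1" 5 10] qpoch_monomial_nonzero[OF q(1), of 1 5 10] by (simp add: defs)
qed

private lemma J_factor:
  shows J1_factor: "J 1 * (euler 10)\<^sup>2 = euler 5 * (j 1 * j 4)"
    and J2_factor: "J 2 * (euler 10)\<^sup>2 = euler 5 * (j 2 * j 3)"
  using theta_mod5_factor[OF q, of 1 1] theta_mod5_factor[OF q, of 2 1] by (simp_all add: reflections)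

text \<open>
  The duplication formula \<open>j(z\<^sup>2; q\<^sup>1\<^sup>0) E\<^sub>5\<^sup>2 = j(z; q\<^sup>5) j(-z; q\<^sup>5) E\<^sub>1\<^sub>0\<close> at \<open>z = q\<close> and at \<open>z = q\<^sup>2\<close>, with
  the second theta function on the right rewritten to base \<open>q\<^sup>1\<^sup>0\<close>.
\<close>
private lemma J_double:
  shows J1_double: "J 1 * (b 1 * b 4) = euler 5 * euler 10 * j 2"
    and J2_double: "J 2 * (b 2 * b 3) = euler 5 * euler 10 * j 4"
proof -
  have nz: "euler 5 \<noteq> 0" "euler 10 \<noteq> 0" by (simp_all add: euler_nonzero)
  have "J 1 * (euler 5 * (b 1 * b 4)) * euler 10 = J 1 * (T (-1) 1 5 * (euler 10)\<^sup>2) * euler 10"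
    using theta_mod5_factor[OF q, of 1 "-1"] by (simp add: reflections)
  also have "\<dots> = j 2 * (euler 5)\<^sup>2 * (euler 10)\<^sup>2"
    using theta_mod5_double[OF q, of 1] by (simp add: mult_ac)
  finally show "J 1 * (b 1 * b 4) = euler 5 * euler 10 * j 2"
    using nz by (simp add: power2_eq_square mult_ac)
  have "J 2 * (euler 5 * (b 2 * b 3)) * euler 10 = J 2 * (T (-1) 2 5 * (euler 10)\<^sup>2) * euler 10"
    using theta_mod5_factor[OF q, of 2 "-1"] by (simp add: reflections)
  also have "\<dots> = j 4 * (euler 5)\<^sup>2 * (euler 10)\<^sup>2"
    using theta_mod5_double[OF q, of 2] by (simp add: mult_ac)
  finally show "J 2 * (b 2 * b 3) = euler 5 * euler 10 * j 4"
    using nz by (simp add: power2_eq_square mult_ac)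
qed

text \<open>
  The factor \<open>b\<^sub>2 b\<^sub>4\<close> makes the duplication formulas \<open>J_double\<close> applicable to one of the two \<open>J\<close>'s in each
  term, and \<open>E\<^sub>1\<^sub>0\<^sup>2\<close> turns the other one into theta functions of modulus ten. What is left in both terms
  besides the common factor is \<open>j\<^sub>3 b\<^sub>4\<close> and \<open>q j\<^sub>1 b\<^sub>2\<close>, to which \<open>factor_sum\<close> applies.
\<close>
private lemma phi_relation: "(J 2)\<^sup>2 * b 3 + q * (J 1)\<^sup>2 * b 1 = T (-1) 1 2 * (J 1 * J 2)"
proof -
  have "((J 2)\<^sup>2 * b 3 + q * (J 1)\<^sup>2 * b 1) * (b 2 * b 4 * (euler 10) ^ 4 * (k 5)\<^sup>2)
     = (euler 10)\<^sup>2 * (k 5)\<^sup>2 * ((J 2 * (euler 10)\<^sup>2) * (J 2 * (b 2 * b 3)) * b 4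
          + q * (J 1 * (euler 10)\<^sup>2) * (J 1 * (b 1 * b 4)) * b 2)"
    by (simp add: eval_nat_numeral algebra_simps)
  also have "\<dots> = (euler 10) ^ 3 * (euler 5)\<^sup>2 * (j 2 * j 4) * ((k 5)\<^sup>2 * (j 3 * b 4 + q * (j 1 * b 2)))"
    unfolding J_double J_factor by (simp add: eval_nat_numeral algebra_simps)
  also have "\<dots> = (euler 5)\<^sup>2 * (j 2 * j 4) * ((euler 10) ^ 3 * (j 2 * j 4) * (b 1 * b 3))"
    unfolding factor_sum by (simp add: mult_ac)
  also have "\<dots> = T (-1) 1 2 * (euler 5 * (j 1 * j 4)) * (euler 5 * (j 2 * j 3)) * (b 2 * b 4 * (k 5)\<^sup>2)"
    unfolding phi_mod10 by (simp add: eval_nat_numeral mult_ac)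
  also have "\<dots> = T (-1) 1 2 * (J 1 * J 2) * (b 2 * b 4 * (euler 10) ^ 4 * (k 5)\<^sup>2)"
    unfolding J_factor[symmetric] by (simp add: eval_nat_numeral mult_ac)
  finally show ?thesis
    by (simp add: jtheta_monomial_nonzero euler_nonzero)
qed

text \<open>
  As for \<open>phi_relation\<close>, with \<open>b\<^sub>1 b\<^sub>3\<close> as the auxiliary factor, which leads to \<open>sum_mod20\<close>.
\<close>
private lemma psi_relation: "(J 2)\<^sup>2 * b 2 + (J 1)\<^sup>2 * b 4 = T (-1) 0 2 * (J 1 * J 2)"
proof -
  have "((J 2)\<^sup>2 * b 2 + (J 1)\<^sup>2 * b 4) * (b 1 * b 3 * (euler 10) ^ 4)
     = (euler 10)\<^sup>2 * ((J 2 * (euler 10)\<^sup>2) * (J 2 * (b 2 * b 3)) * b 1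
          + (J 1 * (euler 10)\<^sup>2) * (J 1 * (b 1 * b 4)) * b 3)"
    by (simp add: eval_nat_numeral algebra_simps)
  also have "\<dots> = (euler 10) ^ 3 * (euler 5)\<^sup>2 * (j 2 * j 4) * (j 3 * b 1 + j 1 * b 3)"
    unfolding J_double J_factor by (simp add: eval_nat_numeral algebra_simps)
  also have "\<dots> = (euler 5)\<^sup>2 * (j 2 * j 4) * (2 * (euler 10) ^ 3 * (k 4 * k 8))"
    unfolding sum_mod20 by (simp add: mult_ac)
  also have "\<dots> = T (-1) 0 2 * (euler 5 * (j 1 * j 4)) * (euler 5 * (j 2 * j 3)) * (b 1 * b 3)"
    unfolding psi_mod10 by (simp add: eval_nat_numeral mult_ac)
  also have "\<dots> = T (-1) 0 2 * (J 1 * J 2) * (b 1 * b 3 * (euler 10) ^ 4)"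
    unfolding J_factor[symmetric] by (simp add: eval_nat_numeral mult_ac)
  finally show ?thesis
    by (simp add: jtheta_monomial_nonzero euler_nonzero)
qed

text \<open>
  The two relations above are linear in \<open>\<phi>\<close> and \<open>\<psi>\<close>; eliminating by Cramer's rule, the
  determinant \<open>b\<^sub>3 b\<^sub>4 - q b\<^sub>1 b\<^sub>2\<close> is \<open>J\<^sub>1 J\<^sub>2\<close> and cancels.
\<close>
lemma mod5_squares:
  shows "T (-1) 1 2 * b 4 - q * T (-1) 0 2 * b 1 = (J 2)\<^sup>2"
    and "T (-1) 0 2 * b 3 - T (-1) 1 2 * b 2 = (J 1)\<^sup>2"
    and "T (-1) 0 2 * b 5 - q * T (-1) 1 2 * b 0 = 2 * (J 1 * J 2)"
proof -
  have nz: "J 1 * J 2 \<noteq> 0" by (simp add: jtheta_monomial_nonzero)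
  have "(T (-1) 1 2 * b 4 - q * T (-1) 0 2 * b 1) * (J 1 * J 2)
      = (T (-1) 1 2 * (J 1 * J 2)) * b 4 - q * (T (-1) 0 2 * (J 1 * J 2)) * b 1"
    by (simp add: algebra_simps)
  also have "\<dots> = (J 2)\<^sup>2 * (b 3 * b 4 - q * (b 1 * b 2))"
    unfolding phi_relation[symmetric] psi_relation[symmetric] by (simp add: algebra_simps)
  finally show eq2: "T (-1) 1 2 * b 4 - q * T (-1) 0 2 * b 1 = (J 2)\<^sup>2"
    using nz unfolding J1_J2[symmetric] by simp
  have "(T (-1) 0 2 * b 3 - T (-1) 1 2 * b 2) * (J 1 * J 2)
      = (T (-1) 0 2 * (J 1 * J 2)) * b 3 - (T (-1) 1 2 * (J 1 * J 2)) * b 2"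
    by (simp add: algebra_simps)
  also have "\<dots> = (J 1)\<^sup>2 * (b 3 * b 4 - q * (b 1 * b 2))"
    unfolding phi_relation[symmetric] psi_relation[symmetric] by (simp add: algebra_simps)
  finally show eq1: "T (-1) 0 2 * b 3 - T (-1) 1 2 * b 2 = (J 1)\<^sup>2"
    using nz unfolding J1_J2[symmetric] by simp
  \<comment> \<open>The orthogonality relations of the cross product in \<open>mod5_products\<close>.\<close>
  have b5: "b 5 * (J 1 * J 2) = (J 2)\<^sup>2 * b 3 - q * (J 1)\<^sup>2 * b 1"
    unfolding mod5_products by (simp add: power2_eq_square algebra_simps)
  have b0: "q * b 0 * (J 1 * J 2) = (J 2)\<^sup>2 * b 2 - (J 1)\<^sup>2 * b 4"
    unfolding mod5_products by (simp add: power2_eq_square algebra_simps)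
  have "(T (-1) 0 2 * b 5 - q * T (-1) 1 2 * b 0) * (J 1 * J 2)
      = T (-1) 0 2 * (b 5 * (J 1 * J 2)) - T (-1) 1 2 * (q * b 0 * (J 1 * J 2))"
    by (simp add: algebra_simps)
  also have "\<dots> = (J 2)\<^sup>2 * (T (-1) 0 2 * b 3 - T (-1) 1 2 * b 2) + (J 1)\<^sup>2 * (T (-1) 1 2 * b 4 - q * T (-1) 0 2 * b 1)"
    unfolding b5 b0 by (simp add: algebra_simps)
  also have "\<dots> = 2 * (J 1 * J 2) * (J 1 * J 2)"
    unfolding eq1 eq2 by (simp add: power2_eq_square)
  finally show "T (-1) 0 2 * b 5 - q * T (-1) 1 2 * b 0 = 2 * (J 1 * J 2)"
    using nz by simp
qed

section \<open>The dissection as an identity between products\<close>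

context
  fixes x :: complex
  assumes x: "x ^ 5 = q"
begin

private lemma x_nz: "x \<noteq> 0"
  using q x by auto

private lemma pos_values:
  shows "jtheta (q ^ 4) (q ^ 10) = j 4" "jtheta (q ^ 6) (q ^ 10) = j 4" "jtheta (q ^ 8) (q ^ 10) = j 2"
    "jtheta (q ^ 10) (q ^ 10) = 0" "jtheta (q ^ 12) (q ^ 10) = - j 2 / q\<^sup>2"
    "jtheta (q ^ 14) (q ^ 10) = - j 4 / q ^ 4"
  using jtheta_monomial_reflect[OF q(2), of 1 4 10] jtheta_monomial_reflect[OF q(2), of 1 2 10]
    jtheta_monomial_self[OF q, of 10] jtheta_monomial_shift[OF q, of 1 10 2] jtheta_monomial_shift[OF q, of 1 10 4]
  by (simp_all add: jtheta_monomial_def)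

private lemma neg_values:
  shows "jtheta (- (q ^ 4)) (q ^ 10) = b 4" "jtheta (- 1) (q ^ 10) = b 0"
    "jtheta (- (1 / q ^ 4)) (q ^ 10) = b 4 / q ^ 4" "jtheta (- (1 / q ^ 12)) (q ^ 10) = b 2 / q ^ 14"
    "jtheta (- (q ^ 5)) (q ^ 10) = b 5" "jtheta (- q) (q ^ 10) = b 1"
    "jtheta (- (1 / q ^ 7)) (q ^ 10) = b 3 / q ^ 7" "jtheta (- (1 / q ^ 11)) (q ^ 10) = b 1 / q ^ 12"
proof -
  show "jtheta (- (1 / q ^ 4)) (q ^ 10) = b 4 / q ^ 4"
    using jtheta_monomial_neg[OF q, of "-1" 10 4] by simp
  show "jtheta (- (1 / q ^ 7)) (q ^ 10) = b 3 / q ^ 7"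
    using jtheta_monomial_neg[OF q, of "-1" 10 7] jtheta_monomial_reflect[OF q(2), of "-1" 3 10] by simp
  show "jtheta (- (1 / q ^ 12)) (q ^ 10) = b 2 / q ^ 14"
    using jtheta_monomial_neg[OF q, of "-1" 10 12] jtheta_monomial_shift[OF q, of "-1" 10 2]
    by (simp flip: power_add)
  show "jtheta (- (1 / q ^ 11)) (q ^ 10) = b 1 / q ^ 12"
    using jtheta_monomial_neg[OF q, of "-1" 10 11] jtheta_monomial_shift[OF q, of "-1" 10 1]
    by (simp flip: power_Suc)
qed (simp_all add: jtheta_monomial_def)

private lemma range5: "{0..4::int} = {0, 1, 2, 3, 4}"
  by auto

text \<open>
  The index-five product formula; the value \<open>x\<^sup>5 = q\<close> removes \<open>x\<close> from the arguments of all theta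
  functions on the right. The coset \<open>s = 3\<close> contributes a multiple of \<open>j(q\<^sup>1\<^sup>0; q\<^sup>1\<^sup>0) = 0\<close>.
\<close>
private lemma even_part:
  "jtheta (- (x\<^sup>2)) (q\<^sup>2) * jtheta (q * x) (q\<^sup>2)
    = j 4 * b 4 - x * q * j 4 * b 0 + x\<^sup>2 * j 2 * b 4 - x ^ 4 * j 2 * b 2"
proof -
  have "jtheta (- (x\<^sup>2)) (q\<^sup>2) * jtheta (q * x) (q\<^sup>2) = (\<Sum>s\<in>{0..4}. (- (q * x)) powi s * q powi (s\<^sup>2 - s) *
      (jtheta (q powi (4 + 2 * s)) (q ^ 10) * jtheta (- (q powi (4 - 4 * s))) (q ^ 10)))"
  proof (subst jtheta_mult_5[OF q], goal_cases)
    case 3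
    have "(- (x\<^sup>2))\<^sup>2 * (q * x) * q powi (2 + 2 * s) = q powi (4 + 2 * s)" for s
    proof -
      have "(- (x\<^sup>2))\<^sup>2 * (q * x) = q\<^sup>2"
        unfolding x[symmetric] by (simp add: eval_nat_numeral)
      then show ?thesis
        using q power_int_add[of q 2 "2 + 2 * s"] by (simp add: add.assoc[symmetric])
    qed
    moreover have "- (x\<^sup>2) / (q * x)\<^sup>2 * q powi (6 - 4 * s) = - (q powi (4 - 4 * s))" for s
      using q x_nz by (simp add: power_int_diff power_mult_distrib divide_simps eval_nat_numeral)
    ultimately show ?case by simp
  qed (use q x_nz in auto)
  also have "\<dots> = j 4 * b 4 - x * q * j 4 * b 0 + x\<^sup>2 * j 2 * b 4 - x ^ 4 * j 2 * b 2"
    using q unfolding range5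
    by (simp add: power_int_minus_divide pos_values neg_values)
       (simp add: field_simps eval_nat_numeral)
  finally show ?thesis .
qed

text \<open>
  Here the coset \<open>s = 2\<close> contributes a multiple of \<open>j(q\<^sup>1\<^sup>0; q\<^sup>1\<^sup>0) = 0\<close>; as \<open>odd_part\<close> is later multiplied by
  \<open>x\<close>, this is again the residue class \<open>3\<close>.
\<close>
private lemma odd_part:
  "jtheta (- (q * x\<^sup>2)) (q\<^sup>2) * jtheta (q * x) (q\<^sup>2)
    = j 4 * b 5 - x * q * j 2 * b 1 + x ^ 3 * j 2 * b 3 - x ^ 4 * j 4 * b 1"
proof -
  have "jtheta (- (q * x\<^sup>2)) (q\<^sup>2) * jtheta (q * x) (q\<^sup>2) = (\<Sum>s\<in>{0..4}. (- (q * x)) powi s * q powi (s\<^sup>2 - s) *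
      (jtheta (q powi (6 + 2 * s)) (q ^ 10) * jtheta (- (q powi (5 - 4 * s))) (q ^ 10)))"
  proof (subst jtheta_mult_5[OF q], goal_cases)
    case 3
    have "(- (q * x\<^sup>2))\<^sup>2 * (q * x) * q powi (2 + 2 * s) = q powi (6 + 2 * s)" for s
    proof -
      have "(- (q * x\<^sup>2))\<^sup>2 * (q * x) = q ^ 4"
        unfolding x[symmetric] by (simp add: eval_nat_numeral)
      then show ?thesis
        using q power_int_add[of q 4 "2 + 2 * s"] by (simp add: add.assoc[symmetric])
    qed
    moreover have "- (q * x\<^sup>2) / (q * x)\<^sup>2 * q powi (6 - 4 * s) = - (q powi (5 - 4 * s))" for s
      using q x_nz by (simp add: power_int_diff power_mult_distrib divide_simps eval_nat_numeral)
    ultimately show ?case by simp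
  qed (use q x_nz in auto)
  also have "\<dots> = j 4 * b 5 - x * q * j 2 * b 1 + x ^ 3 * j 2 * b 3 - x ^ 4 * j 4 * b 1"
    using q unfolding range5
    by (simp add: power_int_minus_divide pos_values neg_values)
       (simp add: field_simps eval_nat_numeral)
  finally show ?thesis .
qed

lemma theta_dissection:
  "(jtheta (- x) q)\<^sup>2 * jtheta (q * x) (q\<^sup>2)
    = j 4 * (J 2)\<^sup>2 + x * (2 * j 4 * (J 1 * J 2)) + x\<^sup>2 * (j 2 * (J 2)\<^sup>2) + x ^ 4 * (j 2 * (J 1)\<^sup>2)"
proof -
  have "(jtheta (- x) q)\<^sup>2 = jtheta (- (x\<^sup>2)) (q\<^sup>2) * jtheta_monomial q (-1) 1 2
      + x * (jtheta (- (q * x\<^sup>2)) (q\<^sup>2) * jtheta_monomial q (-1) 0 2)"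
    using jtheta_mult[OF q, of "- x" "- x"] x_nz by (simp add: power2_eq_square jtheta_monomial_def mult.assoc)
  then have "(jtheta (- x) q)\<^sup>2 * jtheta (q * x) (q\<^sup>2)
      = jtheta_monomial q (-1) 1 2 * (jtheta (- (x\<^sup>2)) (q\<^sup>2) * jtheta (q * x) (q\<^sup>2))
      + x * jtheta_monomial q (-1) 0 2 * (jtheta (- (q * x\<^sup>2)) (q\<^sup>2) * jtheta (q * x) (q\<^sup>2))"
    by (simp add: algebra_simps)
  \<comment> \<open>Multiplied by \<open>x\<close>, the term \<open>- x\<^sup>4 j\<^sub>4 b\<^sub>1\<close> of \<open>odd_part\<close> returns to the residue class \<open>0\<close>.\<close>
  also have "\<dots> = j 4 * (jtheta_monomial q (-1) 1 2 * b 4 - x ^ 5 * jtheta_monomial q (-1) 0 2 * b 1)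
      + x * (j 4 * (jtheta_monomial q (-1) 0 2 * b 5 - q * jtheta_monomial q (-1) 1 2 * b 0))
      + x\<^sup>2 * (j 2 * (jtheta_monomial q (-1) 1 2 * b 4 - q * jtheta_monomial q (-1) 0 2 * b 1))
      + x ^ 4 * (j 2 * (jtheta_monomial q (-1) 0 2 * b 3 - jtheta_monomial q (-1) 1 2 * b 2))"
    unfolding even_part odd_part by (simp add: algebra_simps eval_nat_numeral)
  finally show ?thesis
    unfolding x mod5_squares by (simp add: mult.assoc mult.left_commute)
qed

end

end

text \<open>
  The expected value of \<open>G r\<close>; the value \<open>0\<close> for \<open>r = 3\<close> allows summing over all residues below five.
\<close>
definition dissection_part :: "nat \<Rightarrow> complex \<Rightarrow> complex" where
  "dissection_part r q =
    (if r = 0 then 1 / ((qpochs [q, q ^ 4] (q ^ 5))\<^sup>2 * qpochs [q ^ 2, q ^ 8] (q ^ 10))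
     else if r = 1 then 2 / (qpochs [q, q ^ 2, q ^ 3, q ^ 4] (q ^ 5) * qpochs [q ^ 2, q ^ 8] (q ^ 10))
     else if r = 2 then 1 / ((qpochs [q, q ^ 4] (q ^ 5))\<^sup>2 * qpochs [q ^ 4, q ^ 6] (q ^ 10))
     else if r = 4 then 1 / ((qpochs [q ^ 2, q ^ 3] (q ^ 5))\<^sup>2 * qpochs [q ^ 4, q ^ 6] (q ^ 10))
     else 0)"

text \<open>
  Dividing \<open>theta_dissection\<close> by \<open>E\<^sub>1\<^sup>2 E\<^sub>2\<close>. The reciprocal products arise because \<open>J\<^sub>1 J\<^sub>2 = E\<^sub>1 E\<^sub>5\<close> and
  \<open>j\<^sub>2 j\<^sub>4 = E\<^sub>2 E\<^sub>1\<^sub>0\<close>: dividing one member of such a pair by the right-hand side leaves the reciprocal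
  of the other.
\<close>
lemma product_dissection:
  assumes x: "norm x < 1" "x \<noteq> 0"
  shows "gen_prod x = (\<Sum>r<5. x ^ r * dissection_part r (x ^ 5))"
proof -
  define q where "q = x ^ 5"
  have q: "norm q < 1" "q \<noteq> 0"
    using x norm_power_less_one[of x 5] by (auto simp: q_def)
  define e where "e n = qpoch_monomial q 1 n n" for n
  have e_nz: "e n \<noteq> 0" if "n > 0" for n
    unfolding e_def using q that by (intro qpoch_monomial_nonzero) auto
  let ?j = "\<lambda>n. jtheta_monomial q 1 n 10" and ?J = "\<lambda>n. jtheta_monomial q 1 n 5"
  have j2: "?j 2 = qpochs [q ^ 2, q ^ 8] (q ^ 10) * e 10"
    and j4: "?j 4 = qpochs [q ^ 4, q ^ 6] (q ^ 10) * e 10"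
    and J1: "?J 1 = qpochs [q, q ^ 4] (q ^ 5) * e 5"
    and J2: "?J 2 = qpochs [q ^ 2, q ^ 3] (q ^ 5) * e 5"
    using q by (simp_all add: jtheta_monomial_eq_poch qpoch_monomial_def qpochs_def e_def)
  have e2: "qpochs [q ^ 2, q ^ 8] (q ^ 10) * qpochs [q ^ 4, q ^ 6] (q ^ 10) * e 10 = e 2"
    using split_poch_5[OF q, of 2 1 2] by (simp add: qpoch_monomial_def qpochs_def e_def mult_ac)
  have e1: "qpochs [q, q ^ 4] (q ^ 5) * qpochs [q ^ 2, q ^ 3] (q ^ 5) * e 5 = e 1"
    using split_poch_5[OF q, of 1 1 1] by (simp add: qpoch_monomial_def qpochs_def e_def mult_ac numeral_2_eq_2[symmetric])
  have split4: "qpochs [q, q ^ 2, q ^ 3, q ^ 4] (q ^ 5) = qpochs [q, q ^ 4] (q ^ 5) * qpochs [q ^ 2, q ^ 3] (q ^ 5)"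
    by (simp add: qpochs_def mult_ac)
  have "gen_prod x * ((e 1)\<^sup>2 * e 2) = (jtheta (- x) q)\<^sup>2 * jtheta (q * x) (q\<^sup>2)"
  proof -
    have "q / - x = - (x ^ 4)" "q * x = x ^ 6" "q\<^sup>2 / (q * x) = x ^ 4" "q\<^sup>2 = x ^ 10"
      using x(2) by (simp_all add: q_def eval_nat_numeral)
    then show ?thesis
      by (simp add: gen_prod_def jtheta_def qpochs_def e_def qpoch_monomial_def q_def[symmetric] power_mult_distrib mult_ac)
  qed
  also have "\<dots> = ?j 4 * (?J 2)\<^sup>2 + x * (2 * ?j 4 * (?J 1 * ?J 2)) + x\<^sup>2 * (?j 2 * (?J 2)\<^sup>2) + x ^ 4 * (?j 2 * (?J 1)\<^sup>2)"
    by (rule theta_dissection[OF q q_def[symmetric]])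
  also have "\<dots> = (dissection_part 0 q + x * dissection_part 1 q + x\<^sup>2 * dissection_part 2 q
      + x ^ 4 * dissection_part 4 q) * ((e 1)\<^sup>2 * e 2)"
  proof -
    define A B C D where defs: "A = qpochs [q, q ^ 4] (q ^ 5)" "B = qpochs [q ^ 2, q ^ 3] (q ^ 5)"
      "C = qpochs [q ^ 2, q ^ 8] (q ^ 10)" "D = qpochs [q ^ 4, q ^ 6] (q ^ 10)"
    have nz: "A \<noteq> 0" "B \<noteq> 0" "C \<noteq> 0" "D \<noteq> 0"
      using e1 e2 e_nz[of 1] e_nz[of 2] unfolding defs by auto
    have parts: "dissection_part 0 q * ((e 1)\<^sup>2 * e 2) = ?j 4 * (?J 2)\<^sup>2"
      "dissection_part 1 q * ((e 1)\<^sup>2 * e 2) = 2 * ?j 4 * (?J 1 * ?J 2)"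
      "dissection_part 2 q * ((e 1)\<^sup>2 * e 2) = ?j 2 * (?J 2)\<^sup>2"
      "dissection_part 4 q * ((e 1)\<^sup>2 * e 2) = ?j 2 * (?J 1)\<^sup>2"
      unfolding dissection_part_def j2 j4 J1 J2 split4 e1[symmetric] e2[symmetric]
      unfolding defs[symmetric] using nz by (simp_all add: power2_eq_square field_simps)
    show ?thesis by (simp only: distrib_right mult.assoc parts)
  qed
  finally have "gen_prod x = dissection_part 0 q + x * dissection_part 1 q + x\<^sup>2 * dissection_part 2 q
      + x ^ 4 * dissection_part 4 q"
    using e_nz[of 1] e_nz[of 2] by simp
  then show ?thesis
    by (simp add: eval_nat_numeral lessThan_Suc q_def dissection_part_def)
qed

section \<open>Integrality of the coefficients\<close>

lemma qpoch_power_uniform_limit: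
  assumes r: "r < 1" and ab: "a > 0" "b > 0"
  shows "uniform_limit (cball 0 r) (\<lambda>N q. \<Prod>n<N. 1 - c * q ^ a * (q ^ b) ^ n)
           (\<lambda>q. qpoch (c * q ^ a) (q ^ b)) sequentially"
proof -
  let ?f = "\<lambda>n (q::complex). 1 - c * q ^ a * (q ^ b) ^ n"
  have bound: "norm (?f n q - 1) \<le> norm c * \<bar>r\<bar> ^ n" if "q \<in> cball 0 r" for n q
  proof -
    have q: "norm q \<le> \<bar>r\<bar>" "norm q \<le> 1"
      using that r by auto
    have "norm (?f n q - 1) = norm c * (norm q ^ a * norm q ^ (b * n))"
      by (simp add: norm_mult norm_power power_mult mult.assoc)
    also have "norm q ^ a * norm q ^ (b * n) \<le> 1 * norm q ^ n"
      using q ab by (intro mult_mono power_le_one power_decreasing) auto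
    also have "1 * norm q ^ n \<le> \<bar>r\<bar> ^ n"
      using power_mono[OF q(1), of n] by simp
    finally show ?thesis
      by (simp add: mult_left_mono)
  qed
  have "uniformly_convergent_on (cball 0 r) (\<lambda>N q. \<Prod>n<N. ?f n q)"
  proof (cases "r < 0")
    case False
    show ?thesis
    proof (rule uniformly_convergent_on_prod')
      show "uniformly_convergent_on (cball 0 r) (\<lambda>N q. \<Sum>n<N. norm (?f n q - 1))"
        using bound r False
        by (intro Weierstrass_m_test'[where M = "\<lambda>n. norm c * \<bar>r\<bar> ^ n"] summable_mult summable_geometric) auto
    qed (auto intro!: continuous_intros)
  qed (auto simp: uniformly_convergent_on_def)
  then have ul: "uniform_limit (cball 0 r) (\<lambda>N q. \<Prod>n<N. ?f n q) (\<lambda>q. lim (\<lambda>N. \<Prod>n<N. ?f n q)) sequentially"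
    by (simp only: uniformly_convergent_uniform_limit_iff)
  have lim: "lim (\<lambda>N. \<Prod>n<N. ?f n q) = qpoch (c * q ^ a) (q ^ b)" if "q \<in> cball 0 r" for q
  proof (rule limI)
    have "norm q < 1" using that r by auto
    then show "(\<lambda>N. \<Prod>n<N. ?f n q) \<longlonglongrightarrow> qpoch (c * q ^ a) (q ^ b)"
      using ab by (intro qpoch_LIMSEQ norm_power_less_one)
  qed
  show ?thesis
    using ul by (rule uniform_limit_cong'[THEN iffD1, rotated -1]) (simp_all add: lim)
qed

definition integral_taylor :: "(complex \<Rightarrow> complex) \<Rightarrow> bool" where
  "integral_taylor f \<longleftrightarrow> f holomorphic_on ball 0 1 \<and> (\<forall>n. (deriv ^^ n) f 0 / fact n \<in> \<int>)"

lemma integral_taylor_mult: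
  assumes "integral_taylor f" "integral_taylor g"
  shows "integral_taylor (\<lambda>q. f q * g q)"
  unfolding integral_taylor_def
proof (intro conjI allI)
  show "(\<lambda>q. f q * g q) holomorphic_on ball 0 1"
    using assms by (auto simp: integral_taylor_def intro: holomorphic_intros)
  fix n
  have "(deriv ^^ n) (\<lambda>q. f q * g q) 0 / fact n
      = (\<Sum>i=0..n. ((deriv ^^ i) f 0 / fact i) * ((deriv ^^ (n - i)) g 0 / fact (n - i)))"
    using assms
    by (subst higher_deriv_mult[where S = "ball 0 1"])
       (auto simp: integral_taylor_def sum_divide_distrib binomial_fact field_simps intro!: sum.cong)
  also have "\<dots> \<in> \<int>"
    using assms by (intro Ints_sum Ints_mult) (auto simp: integral_taylor_def)
  finally show "(deriv ^^ n) (\<lambda>q. f q * g q) 0 / fact n \<in> \<int>" .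
qed

lemma integral_taylor_power:
  "c \<in> \<int> \<Longrightarrow> integral_taylor (\<lambda>q. 1 - c * q ^ m)"
  unfolding integral_taylor_def
proof (intro conjI allI)
  fix n assume c: "c \<in> \<int>"
  have "(\<lambda>q. 1 - c * q ^ m) has_fps_expansion (1 - fps_const c * fps_X ^ m)"
    by (intro fps_expansion_intros)
  from fps_nth_fps_expansion[OF this, symmetric]
  show "(deriv ^^ n) (\<lambda>q. 1 - c * q ^ m) 0 / fact n \<in> \<int>"
    using c by (auto simp: fps_X_power_iff)
qed (auto intro!: holomorphic_intros)

lemma integral_taylor_prod:
  "(\<And>i. i \<in> I \<Longrightarrow> integral_taylor (f i)) \<Longrightarrow> integral_taylor (\<lambda>q. \<Prod>i\<in>I. f i q)"
proof (induction I rule: infinite_finite_induct)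
  case (insert i I)
  then show ?case by (simp add: integral_taylor_mult)
qed (use integral_taylor_power[of 0] in auto)

text \<open>
  Taylor coefficients are continuous under locally uniform convergence, and \<open>\<int>\<close> is closed, so integrality
  passes from the finite products to the infinite one.
\<close>
lemma integral_taylor_qpoch:
  assumes "c \<in> \<int>" and ab: "a > 0" "b > 0"
  shows "integral_taylor (\<lambda>q. qpoch (c * q ^ a) (q ^ b))"
proof -
  let ?f = "\<lambda>N q. \<Prod>n<N. 1 - c * q ^ a * (q ^ b) ^ n"
  have f: "integral_taylor (?f N)" for N
  proof -
    have "integral_taylor (\<lambda>q. \<Prod>n<N. 1 - c * q ^ (a + b * n))"
      by (intro integral_taylor_prod integral_taylor_power assms(1))
    then show ?thesis by (simp add: power_add power_mult mult.assoc)
  qed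
  show ?thesis
    unfolding integral_taylor_def
  proof (intro conjI allI)
    show "(\<lambda>q. qpoch (c * q ^ a) (q ^ b)) holomorphic_on ball 0 1"
    proof (rule holomorphic_uniform_sequence)
      show "?f N holomorphic_on ball 0 1" for N
        using f by (simp add: integral_taylor_def)
      fix x :: complex assume "x \<in> ball 0 1"
      define d where "d = (1 - norm x) / 2"
      have d: "d > 0" "norm x + d < 1"
        using \<open>x \<in> ball 0 1\<close> by (auto simp: d_def field_simps)
      have sub: "cball x d \<subseteq> cball 0 (norm x + d)"
      proof
        fix y assume "y \<in> cball x d"
        then show "y \<in> cball 0 (norm x + d)"
          using norm_triangle_sub[of y x] by (simp add: dist_norm norm_minus_commute)
      qed
      then have "cball x d \<subseteq> ball 0 1"
        using d by force
      moreover have "uniform_limit (cball x d) ?f (\<lambda>q. qpoch (c * q ^ a) (q ^ b)) sequentially"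
        by (rule uniform_limit_on_subset[OF qpoch_power_uniform_limit[OF d(2) ab] sub])
      ultimately show "\<exists>d>0. cball x d \<subseteq> ball 0 1 \<and>
          uniform_limit (cball x d) ?f (\<lambda>q. qpoch (c * q ^ a) (q ^ b)) sequentially"
        using d(1) by blast
    qed auto
    fix n
    have ul: "uniform_limit (ball 0 (1 / 2)) ?f (\<lambda>q. qpoch (c * q ^ a) (q ^ b)) sequentially"
      by (rule uniform_limit_on_subset[OF qpoch_power_uniform_limit[OF _ ab, of "1 / 2"]]) auto
    have "(\<lambda>N. (deriv ^^ n) (?f N) 0) \<longlonglongrightarrow> (deriv ^^ n) (\<lambda>q. qpoch (c * q ^ a) (q ^ b)) 0"
    proof (rule higher_deriv_complex_uniform_limit[OF ul])
      have "?f N holomorphic_on ball 0 (1 / 2)" for N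
        using f[of N] holomorphic_on_subset[of "?f N" "ball 0 1" "ball 0 (1 / 2)"]
        by (auto simp: integral_taylor_def)
      then show "\<forall>\<^sub>F N in sequentially. ?f N holomorphic_on ball 0 (1 / 2)"
        by simp
    qed auto
    then have "(\<lambda>N. (deriv ^^ n) (?f N) 0 / fact n) \<longlonglongrightarrow> (deriv ^^ n) (\<lambda>q. qpoch (c * q ^ a) (q ^ b)) 0 / fact n"
      by (intro tendsto_intros) auto
    then show "(deriv ^^ n) (\<lambda>q. qpoch (c * q ^ a) (q ^ b)) 0 / fact n \<in> \<int>"
      by (rule Lim_in_closed_set[OF closed_Ints, rotated 2]) (use f in \<open>auto simp: integral_taylor_def\<close>)
  qed
qed

lemma integral_taylor_gen_prod: "integral_taylor gen_prod"
proof -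
  have [simp]: "integral_taylor (\<lambda>q. qpoch (- q) (q ^ 5))" "integral_taylor (\<lambda>q. qpoch (- (q ^ 4)) (q ^ 5))"
    "integral_taylor (\<lambda>q. qpoch (q ^ 4) (q ^ 10))" "integral_taylor (\<lambda>q. qpoch (q ^ 6) (q ^ 10))"
    using integral_taylor_qpoch[of "-1" 1 5] integral_taylor_qpoch[of "-1" 4 5]
      integral_taylor_qpoch[of 1 4 10] integral_taylor_qpoch[of 1 6 10] by simp_all
  have "gen_prod = (\<lambda>q. (qpoch (- q) (q ^ 5) * qpoch (- (q ^ 4)) (q ^ 5)) * (qpoch (- q) (q ^ 5) * qpoch (- (q ^ 4)) (q ^ 5))
      * (qpoch (q ^ 4) (q ^ 10) * qpoch (q ^ 6) (q ^ 10)))"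
    by (simp add: gen_prod_def qpochs_def power2_eq_square fun_eq_iff)
  moreover have "integral_taylor \<dots>"
    by (intro integral_taylor_mult) auto
  ultimately show ?thesis by simp
qed

lemma powser_coeff_eq_deriv:
  assumes "\<And>q::complex. norm q < 1 \<Longrightarrow> (\<lambda>n. a n * q ^ n) sums f q"
  shows "a n = (deriv ^^ n) f 0 / fact n"
proof -
  have "f has_fps_expansion Abs_fps a"
    by (rule has_fps_expansionI) (use assms in \<open>auto simp: eventually_nhds intro!: exI[of _ "ball 0 1"]\<close>)
  from fps_nth_fps_expansion[OF this] show ?thesis by simp
qed

lemma gen_prod_sums:
  assumes "norm q < 1"
  shows "(\<lambda>n. of_int (g1 n) * q ^ n) sums gen_prod q"
proof -
  have "\<forall>n. \<exists>k. of_int k = (deriv ^^ n) gen_prod 0 / fact n"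
    using integral_taylor_gen_prod unfolding integral_taylor_def Ints_def by (auto simp: image_iff eq_commute)
  then obtain g where g: "of_int (g n) = (deriv ^^ n) gen_prod 0 / fact n" for n
    using choice[of "\<lambda>n k. of_int k = (deriv ^^ n) gen_prod 0 / fact n"] by blast
  have "g1 = g"
    unfolding g1_def
  proof (rule the_equality)
    show "\<forall>q. norm q < 1 \<longrightarrow> (\<lambda>n. of_int (g n) * q ^ n) sums gen_prod q"
      using holomorphic_power_series[of gen_prod 0 1] integral_taylor_gen_prod
      by (auto simp: g integral_taylor_def)
    fix h assume "\<forall>q. norm q < 1 \<longrightarrow> (\<lambda>n. of_int (h n) * q ^ n) sums gen_prod q"
    then have "of_int (h n) = (of_int (g n) :: complex)" for n
      unfolding g by (intro powser_coeff_eq_deriv) auto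
    then show "h = g" by auto
  qed
  then show ?thesis
    using holomorphic_power_series[of gen_prod 0 1 q] integral_taylor_gen_prod assms
    unfolding \<open>g1 = g\<close> g by (simp add: integral_taylor_def)
qed

section \<open>Comparison of residue classes\<close>

text \<open>
  The series is a subseries of the absolutely convergent series of the product at a fifth root \<open>y\<close> of
  \<open>\<bar>q\<bar>\<close>, up to the factor \<open>\<bar>y\<bar>\<^sup>r\<close>.
\<close>
lemma G_sums:
  assumes "norm q < 1"
  shows "(\<lambda>n. of_int (g1 (5 * n + r)) * q ^ n) sums G r q"
proof (cases "q = 0")
  case True
  then show ?thesis
    unfolding G_def using powser_sums_zero[of "\<lambda>n. of_int (g1 (5 * n + r))"] by (simp add: sums_iff)
next
  case False
  define y where "y = complex_of_real (root 5 (norm q))"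
  have y5: "norm y ^ 5 = norm q"
    by (simp add: y_def)
  have "norm y < 1"
    using assms by (simp add: y_def)
  have "norm y > 0"
    using False by (simp add: y_def)
  have "summable (\<lambda>n. norm (of_int (g1 n) * y ^ n))"
  proof (rule powser_insidea)
    define z where "z = complex_of_real ((1 + norm y) / 2)"
    have z: "norm z = (1 + norm y) / 2"
      unfolding z_def norm_of_real by simp
    then show "norm y < norm z"
      using \<open>norm y < 1\<close> by simp
    show "summable (\<lambda>n. of_int (g1 n) * z ^ n)"
      using \<open>norm y < 1\<close> z by (intro sums_summable[OF gen_prod_sums]) simp
  qed
  then have "summable ((\<lambda>n. norm (of_int (g1 n) * y ^ n)) \<circ> (\<lambda>n. 5 * n + r))"
    by (rule summable_reindex) (auto simp: inj_def)
  moreover have "norm (of_int (g1 (5 * n + r)) * y ^ (5 * n + r))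
      = norm y ^ r * norm (of_int (g1 (5 * n + r)) * q ^ n)" for n
    by (simp add: norm_mult norm_power power_add power_mult y5)
  ultimately have "summable (\<lambda>n. norm y ^ r * norm (of_int (g1 (5 * n + r)) * q ^ n))"
    by (simp add: o_def)
  then have "summable (\<lambda>n. norm (of_int (g1 (5 * n + r)) * q ^ n))"
    using summable_cmult_iff[of "norm y ^ r"] \<open>norm y > 0\<close> by auto
  then show ?thesis
    unfolding G_def by (rule summable_sums[OF summable_norm_cancel])
qed

lemma gen_prod_series_dissection:
  assumes "norm q < 1"
  shows "gen_prod q = (\<Sum>r<5. q ^ r * G r (q ^ 5))"
proof -
  have "norm (q ^ 5) < 1"
    using norm_power_less_one[OF assms] by simp
  then have "(\<lambda>n. \<Sum>r<5. q ^ r * (of_int (g1 (5 * n + r)) * (q ^ 5) ^ n)) sums (\<Sum>r<5. q ^ r * G r (q ^ 5))"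
    by (intro sums_sum sums_mult G_sums)
  moreover have "(\<lambda>n. \<Sum>m=n * 5..<n * 5 + 5. of_int (g1 m) * q ^ m) sums gen_prod q"
    by (rule sums_group[OF gen_prod_sums[OF assms]]) simp
  moreover have "(\<Sum>m=n * 5..<n * 5 + 5. of_int (g1 m) * q ^ m) = (\<Sum>r<5. q ^ r * (of_int (g1 (5 * n + r)) * (q ^ 5) ^ n))" for n
    by (rule sum.reindex_bij_witness[of _ "\<lambda>r. 5 * n + r" "\<lambda>m. m - 5 * n"])
       (auto simp: mult_ac simp flip: power_mult power_add)
  ultimately show ?thesis
    by (simp add: sums_iff)
qed

text \<open>
  For fixed \<open>x\<close>, both sides are polynomials in \<open>w\<close> of degree less than \<open>n\<close>, and they agree at the \<open>n\<close>
  roots of unity.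
\<close>
lemma residue_components_unique:
  fixes A B :: "nat \<Rightarrow> complex" and x :: complex
  assumes "n > 0" "x \<noteq> 0" and r: "r < n"
    and eq: "\<And>w. w ^ n = 1 \<Longrightarrow> (\<Sum>r<n. (w * x) ^ r * A r) = (\<Sum>r<n. (w * x) ^ r * B r)"
  shows "A r = B r"
proof -
  define p where "p C = (\<Sum>r<n. monom (x ^ r * C r) r)" for C :: "nat \<Rightarrow> complex"
  have deg: "degree (p C) < card {w::complex. w ^ n = 1}" for C
  proof -
    have "degree (p C) \<le> n - 1"
      unfolding p_def by (intro degree_sum_le) (auto intro: order_trans[OF degree_monom_le])
    then show ?thesis
      using assms(1) by (simp add: card_roots_unity_eq)
  qed
  have "poly (p C) w = (\<Sum>r<n. (w * x) ^ r * C r)" for C w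
    unfolding p_def poly_sum by (intro sum.cong refl) (simp add: poly_monom power_mult_distrib)
  then have "p A = p B"
    by (intro poly_eqI_degree[of "{w. w ^ n = 1}"] deg) (auto simp: eq)
  moreover have "coeff (p C) r = x ^ r * C r" for C
    unfolding p_def using r by (simp add: coeff_sum)
  ultimately have "x ^ r * A r = x ^ r * B r"
    by metis
  then show ?thesis using assms(2) by simp
qed

text \<open>
  The two dissections of the product are compared at \<open>w x\<close> for the fifth roots of unity \<open>w\<close>, all of which
  have the same fifth power \<open>q\<close>.
\<close>
lemma G_eq_punctured:
  assumes "norm q < 1" "q \<noteq> 0" "r < 5"
  shows "G r q = dissection_part r q"
proof -
  obtain x where x: "x ^ 5 = q"
    using exists_complex_root[of 5 q] by auto
  have nx: "norm x < 1"
    using assms(1) by (simp add: norm_power power_less_one_iff flip: x)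
  show ?thesis
  proof (rule residue_components_unique[of 5 x r])
    fix w :: complex assume w: "w ^ 5 = 1"
    then have "norm w = 1"
      by (metis norm_one norm_power power_eq_1_iff norm_ge_zero zero_neq_numeral)
    then have "norm (w * x) < 1" "w * x \<noteq> 0"
      using nx x assms(2) by (auto simp: norm_mult)
    moreover have "(w * x) ^ 5 = q"
      by (simp add: power_mult_distrib w x)
    ultimately show "(\<Sum>r<5. (w * x) ^ r * G r q) = (\<Sum>r<5. (w * x) ^ r * dissection_part r q)"
      using gen_prod_series_dissection[of "w * x"] product_dissection[of "w * x"] by simp
  qed (use x assms in auto)
qed

lemma qpoch_power_tendsto:
  assumes "a > 0" "b > 0"
  shows "((\<lambda>q. qpoch (q ^ a) (q ^ b)) \<longlongrightarrow> qpoch 0 0) (at 0)"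
proof -
  have "(\<lambda>q. qpoch (q ^ a) (q ^ b)) holomorphic_on ball 0 1"
    using integral_taylor_qpoch[OF _ assms, of 1] by (simp add: integral_taylor_def)
  then have "isCont (\<lambda>q. qpoch (q ^ a) (q ^ b)) 0"
    by (intro continuous_on_interior[OF holomorphic_on_imp_continuous_on]) auto
  then show ?thesis
    using assms by (simp add: isCont_def zero_power)
qed

text \<open>
  At \<open>q = 0\<close>, where the comparison of residue classes breaks down, the value is recovered by continuity.
\<close>
lemma dissection_part_tendsto: "((\<lambda>q. dissection_part r q) \<longlongrightarrow> dissection_part r 0) (at 0)"
proof -
  define c where "c = qpoch 0 0"
  have nz: "c \<noteq> 0"
    unfolding c_def by (rule qpoch_nonzero) auto
  note L = qpoch_power_tendsto[folded c_def]
  have pair: "((\<lambda>q. qpochs [q ^ a, q ^ b] (q ^ m)) \<longlongrightarrow> c * c) (at 0)" if "a > 0" "b > 0" "m > 0" for a b m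
    using tendsto_mult[OF L[of a m] L[of b m]] that by (simp add: qpochs_def)
  have pair1: "((\<lambda>q. qpochs [q, q ^ 4] (q ^ 5)) \<longlongrightarrow> c * c) (at 0)"
    using pair[of 1 4 5] by simp
  have quad: "((\<lambda>q. qpochs [q, q ^ 2, q ^ 3, q ^ 4] (q ^ 5)) \<longlongrightarrow> (c * c) * (c * c)) (at 0)"
    using tendsto_mult[OF pair[of 1 2 5] pair[of 3 4 5]] by (simp add: qpochs_def mult.assoc)
  have at_0: "qpochs [0, 0] 0 = c * c" "qpochs [0, 0, 0, 0] 0 = (c * c) * (c * c)"
    by (simp_all add: qpochs_def c_def)
  have "((\<lambda>q. dissection_part 0 q) \<longlongrightarrow> 1 / ((c * c)\<^sup>2 * (c * c))) (at 0)"
    using tendsto_divide[OF tendsto_const[of 1] tendsto_mult[OF tendsto_power[OF pair1, of 2] pair[of 2 8 10]]] nz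
    by (simp add: dissection_part_def)
  moreover have "((\<lambda>q. dissection_part 1 q) \<longlongrightarrow> 2 / ((c * c) * (c * c) * (c * c))) (at 0)"
    using tendsto_divide[OF tendsto_const[of 2] tendsto_mult[OF quad pair[of 2 8 10]]] nz
    by (simp add: dissection_part_def)
  moreover have "((\<lambda>q. dissection_part 2 q) \<longlongrightarrow> 1 / ((c * c)\<^sup>2 * (c * c))) (at 0)"
    using tendsto_divide[OF tendsto_const[of 1] tendsto_mult[OF tendsto_power[OF pair1, of 2] pair[of 4 6 10]]] nz
    by (simp add: dissection_part_def)
  moreover have "((\<lambda>q. dissection_part 4 q) \<longlongrightarrow> 1 / ((c * c)\<^sup>2 * (c * c))) (at 0)"
    using tendsto_divide[OF tendsto_const[of 1] tendsto_mult[OF tendsto_power[OF pair[of 2 3 5], of 2] pair[of 4 6 10]]] nz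
    by (simp add: dissection_part_def)
  moreover have "dissection_part 0 0 = 1 / ((c * c)\<^sup>2 * (c * c))" "dissection_part 1 0 = 2 / ((c * c) * (c * c) * (c * c))"
    "dissection_part 2 0 = 1 / ((c * c)\<^sup>2 * (c * c))" "dissection_part 4 0 = 1 / ((c * c)\<^sup>2 * (c * c))"
    by (simp_all add: dissection_part_def at_0)
  moreover have "((\<lambda>q. dissection_part r q) \<longlongrightarrow> dissection_part r 0) (at 0)" if "r \<notin> {0, 1, 2, 4}"
    using that by (simp add: dissection_part_def)
  ultimately show ?thesis
    by (cases "r \<in> {0, 1, 2, 4}") auto
qed

lemma G_eq:
  assumes "norm q < 1" "r < 5"
  shows "G r q = dissection_part r q"
proof (cases "q = 0")
  case True
  have "(G r \<longlongrightarrow> of_int (g1 r)) (at 0)"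
    using powser_limit_0[of 1 "\<lambda>n. of_int (g1 (5 * n + r))" "G r"] G_sums by simp
  moreover have "\<forall>\<^sub>F q in at 0. G r q = dissection_part r q"
    using G_eq_punctured[OF _ _ assms(2)] unfolding eventually_at
    by (intro exI[of _ 1]) (auto simp: dist_norm)
  ultimately have "(dissection_part r \<longlongrightarrow> of_int (g1 r)) (at 0)"
    by (simp add: tendsto_cong)
  then have "dissection_part r 0 = of_int (g1 r)"
    using dissection_part_tendsto tendsto_unique[OF trivial_limit_at] by blast
  moreover have "G r 0 = of_int (g1 r)"
    unfolding G_def by simp
  ultimately show ?thesis using True by simp
qed (use G_eq_punctured assms in auto)

theorem theorem1p1:
  fixes q :: complex
  assumes "norm q < 1"
  shows "(\<lambda>n. of_int (g1 n) * q ^ n) sums gen_prod q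
    \<and> gen_prod q = G 0 (q ^ 5) + q * G 1 (q ^ 5) + q ^ 2 * G 2 (q ^ 5) + q ^ 4 * G 4 (q ^ 5)
    \<and> (\<lambda>n. of_int (g1 (5 * n)) * q ^ n) sums G 0 q
    \<and> G 0 q = 1 / ((qpochs [q, q ^ 4] (q ^ 5))\<^sup>2 * qpochs [q ^ 2, q ^ 8] (q ^ 10))
    \<and> (\<lambda>n. of_int (g1 (5 * n + 1)) * q ^ n) sums G 1 q
    \<and> G 1 q = 2 / (qpochs [q, q ^ 2, q ^ 3, q ^ 4] (q ^ 5) * qpochs [q ^ 2, q ^ 8] (q ^ 10))
    \<and> (\<lambda>n. of_int (g1 (5 * n + 2)) * q ^ n) sums G 2 q
    \<and> G 2 q = 1 / ((qpochs [q, q ^ 4] (q ^ 5))\<^sup>2 * qpochs [q ^ 4, q ^ 6] (q ^ 10))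
    \<and> (\<lambda>n. of_int (g1 (5 * n + 4)) * q ^ n) sums G 4 q
    \<and> G 4 q = 1 / ((qpochs [q ^ 2, q ^ 3] (q ^ 5))\<^sup>2 * qpochs [q ^ 4, q ^ 6] (q ^ 10))"
proof -
  have q5: "norm (q ^ 5) < 1"
    using norm_power_less_one[OF assms] by simp
  have "G 3 (q ^ 5) = 0"
    using G_eq[OF q5, of 3] by (simp add: dissection_part_def)
  then have "gen_prod q = G 0 (q ^ 5) + q * G 1 (q ^ 5) + q ^ 2 * G 2 (q ^ 5) + q ^ 4 * G 4 (q ^ 5)"
    using gen_prod_series_dissection[OF assms] by (simp add: eval_nat_numeral lessThan_Suc)
  then show ?thesis
    using gen_prod_sums[OF assms] G_sums[OF assms, of 0] G_sums[OF assms, of 1] G_sums[OF assms, of 2]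
      G_sums[OF assms, of 4] G_eq[OF assms, of 0] G_eq[OF assms, of 1] G_eq[OF assms, of 2] G_eq[OF assms, of 4]
    by (simp add: dissection_part_def)
qed

end
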